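(* Every pseudocyclic scheme of valency $k>1$ and rank at least $4(k-1)k^3$ is a Frobenius scheme and is separable.
   Context: A coherent configuration is a pair $(\Omega,S)$ with $\Omega$ finite and $S$ a partition of $\Omega\times\Omega$ such that the diagonal $1_\Omega$ is a union of elements of $S$, $S$ is closed under transposition, and for $r,s,t\in S$ the number $c_{rs}^t=|\{\beta:(\alpha,\beta)\in r,(\beta,\gamma)\in s\}|$ does not depend on $(\alpha,\gamma)\in t$. A scheme is one with $1_\Omega\in S$; rank $|S|$; $S^\#=S\setminus\{1_\Omega\}$; valency $n_s=|\{\beta:(\alpha,\beta)\in s\}|$. With $\mathcal P$ the set of central primitive idempotents of the adjacency algebra $\mathbb{C}S$, $n_P$ the dimension of an irreducible submodule of $\mathbb{C}^\Omega$ corresponding to $P$, $m_P=\operatorname{rk}(P)/n_P$ and $\mathcal P^\#=\mathcal P\setminus\{\frac1{|\Omega|}J\}$, the scheme is pseudocyclic if $m_P/n_P$ is constant on $\mathcal P^\#$; a pseudocyclic scheme has $n_s=k$ for all $s\in S^\#$ for some $k$, its valency. A Frobenius group is a non-regular transitive permutation group in which only the identity fixes two distinct points; a Frobenius scheme is the scheme (set of orbits on $\Omega\times\Omega$) of a Frobenius group. The scheme is separable if for every scheme $(\Omega',S')$ and every algebraic isomorphism $\varphi:S\to S'$ (bijection with $c_{\varphi(r)\varphi(s)}^{\varphi(t)}=c_{rs}^t$) there is a bijection $f:\Omega\to\Omega'$ with $f(s)=\varphi(s)$ for all $s\in S$. *)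

theory Defs
  imports Complex_Main "HOL-Library.Function_Algebras" "HOL-Combinatorics.Permutations"
begin

definition cnt :: "('a \<times> 'a) set \<Rightarrow> ('a \<times> 'a) set \<Rightarrow> 'a \<Rightarrow> 'a \<Rightarrow> nat" where
  "cnt r s a c = card {b. (a, b) \<in> r \<and> (b, c) \<in> s}"

definition coherent_configuration :: "'a set \<Rightarrow> ('a \<times> 'a) set set \<Rightarrow> bool" where
  "coherent_configuration \<Omega> S \<longleftrightarrow>
     finite \<Omega> \<and>
     (\<forall>s\<in>S. s \<noteq> {} \<and> s \<subseteq> \<Omega> \<times> \<Omega>) \<and>
     (\<forall>r\<in>S. \<forall>s\<in>S. r \<noteq> s \<longrightarrow> r \<inter> s = {}) \<and>
     \<Union>S = \<Omega> \<times> \<Omega> \<and>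
     Id_on \<Omega> = \<Union>{s\<in>S. s \<subseteq> Id_on \<Omega>} \<and>
     (\<forall>s\<in>S. s\<inverse> \<in> S) \<and>
     (\<forall>r\<in>S. \<forall>s\<in>S. \<forall>t\<in>S. \<forall>p\<in>t. \<forall>q\<in>t.
        cnt r s (fst p) (snd p) = cnt r s (fst q) (snd q))"

definition scheme :: "'a set \<Rightarrow> ('a \<times> 'a) set set \<Rightarrow> bool" where
  "scheme \<Omega> S \<longleftrightarrow> coherent_configuration \<Omega> S \<and> Id_on \<Omega> \<in> S"

definition inum :: "('a \<times> 'a) set \<Rightarrow> ('a \<times> 'a) set \<Rightarrow> ('a \<times> 'a) set \<Rightarrow> nat" where
  "inum r s t = (let p = (SOME p. p \<in> t) in cnt r s (fst p) (snd p))"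

definition valency :: "('a \<times> 'a) set \<Rightarrow> nat" where
  "valency s = card {b. (fst (SOME p. p \<in> s), b) \<in> s}"

definition rank :: "('a \<times> 'a) set set \<Rightarrow> nat" where
  "rank S = card S"

text \<open>Complex matrices indexed by \<Omega> \<times> \<Omega> are functions vanishing outside \<Omega> \<times> \<Omega>;
  vectors of \<complex>^\<Omega> are functions vanishing outside \<Omega>.\<close>

definition adj :: "('a \<times> 'a) set \<Rightarrow> 'a \<Rightarrow> 'a \<Rightarrow> complex" where
  "adj s = (\<lambda>x y. if (x, y) \<in> s then 1 else 0)"

definition mmult :: "'a set \<Rightarrow> ('a \<Rightarrow> 'a \<Rightarrow> complex) \<Rightarrow> ('a \<Rightarrow> 'a \<Rightarrow> complex) \<Rightarrow> ('a \<Rightarrow> 'a \<Rightarrow> complex)" where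
  "mmult \<Omega> M N = (\<lambda>x y. \<Sum>z\<in>\<Omega>. M x z * N z y)"

definition matvec :: "'a set \<Rightarrow> ('a \<Rightarrow> 'a \<Rightarrow> complex) \<Rightarrow> ('a \<Rightarrow> complex) \<Rightarrow> ('a \<Rightarrow> complex)" where
  "matvec \<Omega> M v = (\<lambda>x. if x \<in> \<Omega> then \<Sum>y\<in>\<Omega>. M x y * v y else 0)"

definition adjacency_algebra :: "('a \<times> 'a) set set \<Rightarrow> ('a \<Rightarrow> 'a \<Rightarrow> complex) set" where
  "adjacency_algebra S = {M. \<exists>c. M = (\<lambda>x y. \<Sum>s\<in>S. c s * adj s x y)}"

definition central_idempotent :: "'a set \<Rightarrow> ('a \<times> 'a) set set \<Rightarrow> ('a \<Rightarrow> 'a \<Rightarrow> complex) \<Rightarrow> bool" where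
  "central_idempotent \<Omega> S P \<longleftrightarrow>
     P \<in> adjacency_algebra S \<and> P \<noteq> 0 \<and> mmult \<Omega> P P = P \<and>
     (\<forall>M\<in>adjacency_algebra S. mmult \<Omega> P M = mmult \<Omega> M P)"

definition central_primitive_idempotents :: "'a set \<Rightarrow> ('a \<times> 'a) set set \<Rightarrow> ('a \<Rightarrow> 'a \<Rightarrow> complex) set" where
  "central_primitive_idempotents \<Omega> S =
     {P. central_idempotent \<Omega> S P \<and>
         \<not> (\<exists>Q R. central_idempotent \<Omega> S Q \<and> central_idempotent \<Omega> S R \<and>
                  mmult \<Omega> Q R = 0 \<and> P = Q + R)}"

definition cscale :: "complex \<Rightarrow> ('a \<Rightarrow> complex) \<Rightarrow> ('a \<Rightarrow> complex)" where
  "cscale c v = (\<lambda>x. c * v x)"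

abbreviation cdim :: "('a \<Rightarrow> complex) set \<Rightarrow> nat" where
  "cdim \<equiv> Vector_Spaces.vector_space.dim cscale"

abbreviation csubspace :: "('a \<Rightarrow> complex) set \<Rightarrow> bool" where
  "csubspace \<equiv> Modules.module.subspace cscale"

definition cvectors :: "'a set \<Rightarrow> ('a \<Rightarrow> complex) set" where
  "cvectors \<Omega> = {v. \<forall>x. x \<notin> \<Omega> \<longrightarrow> v x = 0}"

definition submodule :: "'a set \<Rightarrow> ('a \<times> 'a) set set \<Rightarrow> ('a \<Rightarrow> complex) set \<Rightarrow> bool" where
  "submodule \<Omega> S U \<longleftrightarrow> csubspace U \<and> U \<subseteq> cvectors \<Omega> \<and>
     (\<forall>M\<in>adjacency_algebra S. \<forall>u\<in>U. matvec \<Omega> M u \<in> U)"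

definition irreducible_submodule :: "'a set \<Rightarrow> ('a \<times> 'a) set set \<Rightarrow> ('a \<Rightarrow> complex) set \<Rightarrow> bool" where
  "irreducible_submodule \<Omega> S U \<longleftrightarrow> submodule \<Omega> S U \<and> U \<noteq> {0} \<and>
     (\<forall>W. submodule \<Omega> S W \<and> W \<subseteq> U \<longrightarrow> W = {0} \<or> W = U)"

text \<open>An irreducible submodule corresponds to P if P acts on it as the identity.\<close>
definition n_P :: "'a set \<Rightarrow> ('a \<times> 'a) set set \<Rightarrow> ('a \<Rightarrow> 'a \<Rightarrow> complex) \<Rightarrow> nat" where
  "n_P \<Omega> S P = cdim (SOME U. irreducible_submodule \<Omega> S U \<and> (\<forall>u\<in>U. matvec \<Omega> P u = u))"

definition mat_rank :: "'a set \<Rightarrow> ('a \<Rightarrow> 'a \<Rightarrow> complex) \<Rightarrow> nat" where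
  "mat_rank \<Omega> P = cdim (range (matvec \<Omega> P))"

definition m_P :: "'a set \<Rightarrow> ('a \<times> 'a) set set \<Rightarrow> ('a \<Rightarrow> 'a \<Rightarrow> complex) \<Rightarrow> real" where
  "m_P \<Omega> S P = real (mat_rank \<Omega> P) / real (n_P \<Omega> S P)"

definition Jnorm :: "'a set \<Rightarrow> 'a \<Rightarrow> 'a \<Rightarrow> complex" where
  "Jnorm \<Omega> = (\<lambda>x y. if x \<in> \<Omega> \<and> y \<in> \<Omega> then 1 / of_nat (card \<Omega>) else 0)"

definition pseudocyclic :: "'a set \<Rightarrow> ('a \<times> 'a) set set \<Rightarrow> bool" where
  "pseudocyclic \<Omega> S \<longleftrightarrow> scheme \<Omega> S \<and>
     (\<exists>c::real. \<forall>P\<in>central_primitive_idempotents \<Omega> S - {Jnorm \<Omega>}.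
        m_P \<Omega> S P / real (n_P \<Omega> S P) = c)"

definition frobenius_group :: "'a set \<Rightarrow> ('a \<Rightarrow> 'a) set \<Rightarrow> bool" where
  "frobenius_group \<Omega> G \<longleftrightarrow>
     (\<forall>g\<in>G. g permutes \<Omega>) \<and> id \<in> G \<and>
     (\<forall>g\<in>G. \<forall>h\<in>G. g \<circ> h \<in> G) \<and> (\<forall>g\<in>G. inv g \<in> G) \<and>
     (\<forall>x\<in>\<Omega>. \<forall>y\<in>\<Omega>. \<exists>g\<in>G. g x = y) \<and>
     (\<exists>g\<in>G. g \<noteq> id \<and> (\<exists>x\<in>\<Omega>. g x = x)) \<and>
     (\<forall>g\<in>G. \<forall>x\<in>\<Omega>. \<forall>y\<in>\<Omega>. x \<noteq> y \<and> g x = x \<and> g y = y \<longrightarrow> g = id)"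

definition orbitals :: "'a set \<Rightarrow> ('a \<Rightarrow> 'a) set \<Rightarrow> ('a \<times> 'a) set set" where
  "orbitals \<Omega> G = {{(g x, g y) | g. g \<in> G} | x y. x \<in> \<Omega> \<and> y \<in> \<Omega>}"

definition frobenius_scheme :: "'a set \<Rightarrow> ('a \<times> 'a) set set \<Rightarrow> bool" where
  "frobenius_scheme \<Omega> S \<longleftrightarrow> (\<exists>G. frobenius_group \<Omega> G \<and> S = orbitals \<Omega> G)"

definition algebraic_isomorphism ::
  "('a \<times> 'a) set set \<Rightarrow> ('b \<times> 'b) set set \<Rightarrow> (('a \<times> 'a) set \<Rightarrow> ('b \<times> 'b) set) \<Rightarrow> bool" where
  "algebraic_isomorphism S S' \<phi> \<longleftrightarrow> bij_betw \<phi> S S' \<and>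
     (\<forall>r\<in>S. \<forall>s\<in>S. \<forall>t\<in>S. inum (\<phi> r) (\<phi> s) (\<phi> t) = inum r s t)"

text \<open>Separability with respect to all schemes whose points have type 'b; stating
  the theorem for an arbitrary type variable 'b yields separability in general.\<close>
definition separable :: "'b itself \<Rightarrow> 'a set \<Rightarrow> ('a \<times> 'a) set set \<Rightarrow> bool" where
  "separable _ \<Omega> S \<longleftrightarrow>
     (\<forall>(\<Omega>'::'b set) S' \<phi>. scheme \<Omega>' S' \<and> algebraic_isomorphism S S' \<phi> \<longrightarrow>
        (\<exists>f. bij_betw f \<Omega> \<Omega>' \<and> (\<forall>s\<in>S. (\<lambda>(x, y). (f x, f y)) ` s = \<phi> s)))"

end

theory Submission
  imports Defs "HOL-Computational_Algebra.Fundamental_Theorem_Algebra"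
begin

text \<open>
  Let \<open>A\<^sub>s\<close> be the adjacency matrices. The element \<open>C = \<Sum>\<^sub>s A\<^sub>s A\<^sub>s\<^sup>* / |s|\<close> is central in the adjacency
  algebra, and Schur orthogonality shows that it acts on the component of a central primitive
  idempotent \<open>P\<close> as the scalar \<open>n\<^sub>P / m\<^sub>P\<close>. For a pseudocyclic scheme it is therefore a combination
  of \<open>I\<close> and \<open>J\<close>; comparing entries, any two distinct points \<open>x, y\<close> have the same relation to
  exactly \<open>k - 1\<close> points \<open>z\<close>.

  Hence a point \<open>d\<close> is usually the only point having its relations to two given points \<open>a, b\<close>,
  and for all but \<open>O(k\<^sup>3)\<close> points \<open>g\<close> the relation of \<open>d\<close> to \<open>g\<close> is the only one compatible with the
  triangles \<open>d, a, g\<close> and \<open>d, b, g\<close>. As triangles are preserved by algebraic isomorphisms \<open>\<phi>\<close>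
  and the number of points exceeds all the exceptional sets together, an assignment \<open>a \<mapsto> a'\<close>,
  \<open>b \<mapsto> b'\<close> that respects \<open>\<phi>\<close> on one pair of distinct points extends to an isomorphism inducing
  \<open>\<phi>\<close>. This is separability; for \<open>\<phi> = id\<close> it shows that the automorphism group is transitive on
  each relation, and an automorphism with two fixed points is trivial.
\<close>

text \<open>The obstacle in the extension is that a triangle over \<open>a\<close>, \<open>b\<close>
  need not pin down the image of its third point: \<open>F\<close> picks one of possibly several
  candidates, and two picks may not fit each other. So \<open>F\<close> serves only as a reference.
  A second map \<open>f\<close> sends each \<open>d\<close> to a point that fits \<open>F g\<close>
  for all but at most \<open>2 * m\<close> points \<open>g\<close>, where
  \<open>m = k * (k * (k - 1))\<close> bounds the failures of \<open>forced\<close>. Two points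
  \<open>d\<close>, \<open>e\<close> are then compared through one \<open>g\<close> outside
  exceptional sets of sizes \<open>2 * m\<close>, \<open>2 * m\<close> and \<open>m\<close>, whence
  the constant 5 in \<open>sparse_scheme\<close>.

  On the algebraic side traces replace the structure theory of semisimple algebras: a submodule is
  handled through its orthogonal projection, whose trace is its dimension, and a Hermitian
  idempotent of trace 0 vanishes. Minimal dimension and minimal rank supply irreducible submodules
  and primitive idempotents.\<close>

section \<open>Matrices indexed by a finite set\<close>

text \<open>If p is an annihilating polynomial of \<open>v\<close> of least degree and p = (X - a)
  q, then q(T) v is nonzero by minimality and is killed by T - a. The eigenvector is given as a
  polynomial in \<open>T\<close> applied to \<open>v\<close>, so that it stays in every
  \<open>T\<close>-invariant subspace containing \<open>v\<close>. This is used for matrices in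
  \<open>central_mult_primitive\<close> and for vectors in \<open>schur\<close>.\<close>

lemma cyclic_eigenvector:
  fixes scale :: "complex \<Rightarrow> 'b::ab_group_add \<Rightarrow> 'b" and T :: "'b \<Rightarrow> 'b"
  assumes vs: "vector_space scale"
    and T_add: "\<And>x y. T (x + y) = T x + T y"
    and T_scale: "\<And>c x. T (scale c x) = scale c (T x)"
    and v: "v \<noteq> 0"
    and B: "finite B" "\<And>n. (T ^^ n) v \<in> module.span scale B"
  shows "\<exists>n c a. (\<Sum>i\<le>n. scale (c i) ((T ^^ i) v)) \<noteq> 0 \<and>
    T (\<Sum>i\<le>n. scale (c i) ((T ^^ i) v)) = scale a (\<Sum>i\<le>(n::nat). scale (c i) ((T ^^ i) v))"
proof -
  interpret vector_space scale by (fact vs)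
  define ev where "ev p = (\<Sum>i\<le>degree p. scale (coeff p i) ((T ^^ i) v))" for p
  have T_0: "T 0 = 0" using T_scale[of 0 0] by simp
  have T_sum: "T (sum f A) = (\<Sum>i\<in>A. T (f i))" for f and A :: "nat set"
    by (induction A rule: infinite_finite_induct) (auto simp: T_0 T_add)
  have ev_le: "ev p = (\<Sum>i\<le>n. scale (coeff p i) ((T ^^ i) v))" if "degree p \<le> n" for p n
    unfolding ev_def
    by (rule sum.mono_neutral_left) (use that in \<open>auto simp: coeff_eq_0\<close>)
  have "\<exists>p. p \<noteq> 0 \<and> ev p = 0"
  \<comment> \<open>Dependence is a property of sets, and the image collapses repeated powers. A
    repetition is therefore treated separately, by the polynomial X^i - X^j.\<close>
  proof (cases "inj (\<lambda>i. (T ^^ i) v)")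
    case True
    let ?I = "{..card B}"
    let ?X = "(\<lambda>i. (T ^^ i) v) ` ?I"
    have inj: "inj_on (\<lambda>i. (T ^^ i) v) ?I" using True by (rule inj_on_subset) simp
    have "card ?X = Suc (card B)" using inj by (simp add: card_image)
    then have "dependent ?X"
      using independent_span_bound[OF B(1), of ?X] B(2) by auto
    then obtain u where u: "\<exists>x\<in>?X. u x \<noteq> 0" "(\<Sum>x\<in>?X. scale (u x) x) = 0"
      using dependent_finite[of ?X] by auto
    define p where "p = (\<Sum>i\<in>?I. monom (u ((T ^^ i) v)) i)"
    have cf: "coeff p i = (if i \<in> ?I then u ((T ^^ i) v) else 0)" for i
      unfolding p_def coeff_sum by (simp add: if_distrib sum.delta cong: if_cong)
    have "degree p \<le> card B" by (rule degree_le) (simp add: cf)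
    then have "ev p = (\<Sum>i\<in>?I. scale (u ((T ^^ i) v)) ((T ^^ i) v))"
      by (simp add: ev_le cf)
    also have "\<dots> = (\<Sum>x\<in>?X. scale (u x) x)" using inj by (simp add: sum.reindex)
    finally have "ev p = 0" using u(2) by simp
    moreover have "p \<noteq> 0" using u(1) cf by (metis (no_types, lifting) coeff_0 imageE)
    ultimately show ?thesis by blast
  next
    case False
    then obtain i j where ij: "i \<noteq> j" "(T ^^ i) v = (T ^^ j) v" by (auto simp: inj_def)
    define p :: "complex poly" where "p = monom 1 i - monom 1 j"
    have cf: "coeff p l = (if l = i then 1 else if l = j then -1 else 0)" for l
      using ij(1) by (auto simp: p_def)
    have "degree p \<le> max i j" by (rule degree_le) (simp add: cf)
    then have "ev p = (\<Sum>l\<le>max i j. scale (coeff p l) ((T ^^ l) v))" by (rule ev_le)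
    also have "\<dots> = (\<Sum>l\<in>{i,j}. scale (coeff p l) ((T ^^ l) v))"
      by (rule sum.mono_neutral_right) (auto simp: cf)
    also have "\<dots> = 0" using ij by (simp add: cf)
    finally have "ev p = 0" .
    moreover have "p \<noteq> 0" using cf[of i] by auto
    ultimately show ?thesis by blast
  qed
  then obtain p where p: "p \<noteq> 0" "ev p = 0" and
    pmin: "\<And>q. q \<noteq> 0 \<Longrightarrow> ev q = 0 \<Longrightarrow> degree p \<le> degree q"
    using ex_has_least_nat[of "\<lambda>p. p \<noteq> 0 \<and> ev p = 0" _ degree] by blast
  have "degree p \<noteq> 0"
  proof
    assume "degree p = 0"
    then have "ev p = scale (coeff p 0) v" by (simp add: ev_def)
    moreover have "coeff p 0 \<noteq> 0" using p(1) \<open>degree p = 0\<close> by (metis leading_coeff_0_iff)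
    ultimately show False using p(2) v by simp
  qed
  then obtain a where "poly p a = 0"
    using fundamental_theorem_of_algebra[of p] by (metis constant_degree)
  then obtain q where q: "p = [:-a, 1:] * q" by (metis dvdE poly_eq_0_iff_dvd)
  have q0: "q \<noteq> 0" using p(1) q by auto
  have dq: "degree p = Suc (degree q)" using q0 unfolding q by (subst degree_mult_eq) auto
  have evq: "ev q \<noteq> 0" using pmin[OF q0] dq by auto
  \<comment> \<open>The shifted coefficients come from the factor X; they turn \<open>ev p\<close>
    into \<open>T (ev q) - scale a (ev q)\<close>.\<close>
  have cfp: "coeff p i = (case i of 0 \<Rightarrow> 0 | Suc j \<Rightarrow> coeff q j) - a * coeff q i" for i
    unfolding q by (cases i) (simp_all add: algebra_simps)
  let ?n = "degree q"
  have "ev p = (\<Sum>i\<le>Suc ?n. scale (case i of 0 \<Rightarrow> 0 | Suc j \<Rightarrow> coeff q j) ((T ^^ i) v))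
      - (\<Sum>i\<le>Suc ?n. scale (a * coeff q i) ((T ^^ i) v))"
    unfolding ev_def dq by (simp only: cfp scale_left_diff_distrib sum_subtractf)
  also have "(\<Sum>i\<le>Suc ?n. scale (case i of 0 \<Rightarrow> 0 | Suc j \<Rightarrow> coeff q j) ((T ^^ i) v))
      = (\<Sum>i\<le>?n. scale (coeff q i) (T ((T ^^ i) v)))"
    by (subst sum.atMost_Suc_shift) simp
  also have "\<dots> = T (ev q)" unfolding ev_def by (simp add: T_sum T_scale)
  also have "(\<Sum>i\<le>Suc ?n. scale (a * coeff q i) ((T ^^ i) v)) = scale a (ev q)"
    unfolding ev_def by (simp add: scale_sum_right coeff_eq_0)
  finally have "T (ev q) = scale a (ev q)" using p(2) by simp
  then show ?thesis using evq unfolding ev_def by blast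
qed

definition mscale :: "complex \<Rightarrow> ('a \<Rightarrow> 'a \<Rightarrow> complex) \<Rightarrow> 'a \<Rightarrow> 'a \<Rightarrow> complex" where
  "mscale c M = (\<lambda>x y. c * M x y)"

definition tr :: "'a set \<Rightarrow> ('a \<Rightarrow> 'a \<Rightarrow> complex) \<Rightarrow> complex" where
  "tr \<Omega> M = (\<Sum>x\<in>\<Omega>. M x x)"

definition adjoint :: "('a \<Rightarrow> 'a \<Rightarrow> complex) \<Rightarrow> 'a \<Rightarrow> 'a \<Rightarrow> complex" where
  "adjoint M = (\<lambda>x y. cnj (M y x))"

text \<open>Matrices are total functions, and the sums in \<open>tr\<close> do not see entries
  outside \<open>\<Omega>\<close>. Only on supported matrices is the trace form definite and
  \<open>One\<close> an identity.\<close>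

definition supported :: "'a set \<Rightarrow> ('a \<Rightarrow> 'a \<Rightarrow> complex) \<Rightarrow> bool" where
  "supported \<Omega> M \<longleftrightarrow> (\<forall>x y. x \<notin> \<Omega> \<or> y \<notin> \<Omega> \<longrightarrow> M x y = 0)"

interpretation cv: vector_space cscale
  by unfold_locales (auto simp: cscale_def fun_eq_iff algebra_simps)

interpretation mv: vector_space mscale
  by unfold_locales (auto simp: mscale_def fun_eq_iff algebra_simps)

lemma mmult_assoc: "mmult \<Omega> (mmult \<Omega> A B) C = mmult \<Omega> A (mmult \<Omega> B C)"
proof (intro ext)
  fix x y
  have "mmult \<Omega> (mmult \<Omega> A B) C x y = (\<Sum>z\<in>\<Omega>. \<Sum>w\<in>\<Omega>. A x w * B w z * C z y)"
    by (simp add: mmult_def sum_distrib_right)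
  also have "\<dots> = (\<Sum>w\<in>\<Omega>. \<Sum>z\<in>\<Omega>. A x w * B w z * C z y)" by (rule sum.swap)
  also have "\<dots> = mmult \<Omega> A (mmult \<Omega> B C) x y"
    by (simp add: mmult_def sum_distrib_left mult.assoc)
  finally show "mmult \<Omega> (mmult \<Omega> A B) C x y = mmult \<Omega> A (mmult \<Omega> B C) x y" .
qed

lemma mmult_linear:
  "mmult \<Omega> (A + B) C = mmult \<Omega> A C + mmult \<Omega> B C"
  "mmult \<Omega> C (A + B) = mmult \<Omega> C A + mmult \<Omega> C B"
  "mmult \<Omega> (A - B) C = mmult \<Omega> A C - mmult \<Omega> B C"
  "mmult \<Omega> C (A - B) = mmult \<Omega> C A - mmult \<Omega> C B"
  "mmult \<Omega> (mscale c A) C = mscale c (mmult \<Omega> A C)"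
  "mmult \<Omega> C (mscale c A) = mscale c (mmult \<Omega> C A)"
  "mmult \<Omega> 0 C = 0"
  "mmult \<Omega> C 0 = 0"
  by (simp_all add: mmult_def mscale_def fun_eq_iff algebra_simps sum.distrib sum_subtractf
      sum_distrib_left)

lemma mmult_sum:
  "mmult \<Omega> (\<Sum>s\<in>I. F s) C = (\<Sum>s\<in>I. mmult \<Omega> (F s) C)"
  "mmult \<Omega> C (\<Sum>s\<in>I. F s) = (\<Sum>s\<in>I. mmult \<Omega> C (F s))"
  by (induction I rule: infinite_finite_induct) (simp_all add: mmult_linear)

lemma tr_linear:
  "tr \<Omega> (A + B) = tr \<Omega> A + tr \<Omega> B"
  "tr \<Omega> (A - B) = tr \<Omega> A - tr \<Omega> B"
  "tr \<Omega> (mscale c A) = c * tr \<Omega> A"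
  "tr \<Omega> 0 = 0"
  by (simp_all add: tr_def mscale_def sum.distrib sum_subtractf sum_distrib_left)

lemma tr_sum: "tr \<Omega> (\<Sum>s\<in>I. F s) = (\<Sum>s\<in>I. tr \<Omega> (F s))"
  by (induction I rule: infinite_finite_induct)
    (simp_all only: tr_linear sum.infinite sum.empty sum.insert not_False_eq_True)

lemma tr_mmult_commute: "tr \<Omega> (mmult \<Omega> A B) = tr \<Omega> (mmult \<Omega> B A)"
  unfolding tr_def mmult_def by (subst sum.swap) (simp add: mult.commute)

lemma adjoint_mmult: "adjoint (mmult \<Omega> A B) = mmult \<Omega> (adjoint B) (adjoint A)"
  by (simp add: adjoint_def mmult_def fun_eq_iff mult.commute)

lemma adjoint_adjoint [simp]: "adjoint (adjoint A) = A"
  by (simp add: adjoint_def)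

lemma tr_adjoint_mmult:
  "tr \<Omega> (mmult \<Omega> (adjoint M) M) = complex_of_real (\<Sum>x\<in>\<Omega>. \<Sum>z\<in>\<Omega>. (cmod (M z x))\<^sup>2)"
  unfolding tr_def mmult_def adjoint_def of_real_sum
  by (intro sum.cong refl) (simp only: complex_norm_square mult.commute)

text \<open>The trace in question is the sum of the squared moduli of the entries. This definiteness
  is a main tool below for proving that a matrix vanishes.\<close>

lemma adjoint_mmult_eq_0:
  assumes "finite \<Omega>" "supported \<Omega> M" "tr \<Omega> (mmult \<Omega> (adjoint M) M) = 0"
  shows "M = 0"
proof -
  have *: "(\<Sum>x\<in>\<Omega>. \<Sum>z\<in>\<Omega>. (cmod (M z x))\<^sup>2) = 0"
    using assms(3) unfolding tr_adjoint_mmult by (simp only: of_real_eq_0_iff)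
  have "M z x = 0" if "x \<in> \<Omega>" "z \<in> \<Omega>" for x z
  proof -
    have "(\<Sum>z\<in>\<Omega>. (cmod (M z x))\<^sup>2) = 0"
      using * that(1) assms(1) by (subst (asm) sum_nonneg_eq_0_iff) (auto intro: sum_nonneg)
    then show ?thesis
      using that(2) assms(1) by (subst (asm) sum_nonneg_eq_0_iff) auto
  qed
  then show ?thesis using assms(2) by (auto simp: supported_def fun_eq_iff)
qed

lemma matvec_mmult: "matvec \<Omega> (mmult \<Omega> M N) v = matvec \<Omega> M (matvec \<Omega> N v)"
proof
  fix x
  show "matvec \<Omega> (mmult \<Omega> M N) v x = matvec \<Omega> M (matvec \<Omega> N v) x"
  proof (cases "x \<in> \<Omega>")
    case True
    have "matvec \<Omega> (mmult \<Omega> M N) v x = (\<Sum>y\<in>\<Omega>. \<Sum>z\<in>\<Omega>. M x z * N z y * v y)"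
      using True by (simp add: matvec_def mmult_def sum_distrib_right)
    also have "\<dots> = (\<Sum>z\<in>\<Omega>. \<Sum>y\<in>\<Omega>. M x z * N z y * v y)" by (rule sum.swap)
    also have "\<dots> = matvec \<Omega> M (matvec \<Omega> N v) x"
      using True by (simp add: matvec_def sum_distrib_left mult.assoc)
    finally show ?thesis .
  qed (simp add: matvec_def)
qed

text \<open>Translates statements on vectors, such as invariance of a subspace, into matrix
  identities, column by column.\<close>

lemma mmult_column:
  "supported \<Omega> M \<Longrightarrow> (\<lambda>x. mmult \<Omega> M N x y) = matvec \<Omega> M (\<lambda>z. N z y)"
  by (auto simp: mmult_def matvec_def supported_def fun_eq_iff)

lemma matvec_linear:
  "matvec \<Omega> M (u + v) = matvec \<Omega> M u + matvec \<Omega> M v"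
  "matvec \<Omega> M (cscale c u) = cscale c (matvec \<Omega> M u)"
  by (auto simp: matvec_def cscale_def fun_eq_iff algebra_simps sum.distrib sum_distrib_left)

lemma cvectors_span:
  assumes "finite \<Omega>"
  shows "\<exists>B. finite B \<and> card B \<le> card \<Omega> \<and> cvectors \<Omega> \<subseteq> cv.span B"
proof -
  let ?e = "\<lambda>x y. if y = x then 1 else 0 :: complex"
  have "v \<in> cv.span (?e ` \<Omega>)" if "v \<in> cvectors \<Omega>" for v
  proof -
    have "v = (\<Sum>x\<in>\<Omega>. cscale (v x) (?e x))"
    proof
      fix y
      have "(\<Sum>x\<in>\<Omega>. cscale (v x) (?e x)) y = (\<Sum>x\<in>\<Omega>. v x * (if y = x then 1 else 0))"
        by (induction \<Omega> rule: infinite_finite_induct) (auto simp: cscale_def)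
      also have "\<dots> = v y" using assms that by (simp add: if_distrib sum.delta cvectors_def cong: if_cong)
      finally show "v y = (\<Sum>x\<in>\<Omega>. cscale (v x) (?e x)) y" by simp
    qed
    moreover have "(\<Sum>x\<in>\<Omega>. cscale (v x) (?e x)) \<in> cv.span (?e ` \<Omega>)"
      by (intro cv.span_sum cv.span_scale cv.span_base) auto
    ultimately show ?thesis by simp
  qed
  then show ?thesis using assms by (intro exI[of _ "?e ` \<Omega>"]) (auto simp: card_image_le)
qed

section \<open>Inner product, orthonormal bases and orthogonal projections\<close>

definition cinner :: "'a set \<Rightarrow> ('a \<Rightarrow> complex) \<Rightarrow> ('a \<Rightarrow> complex) \<Rightarrow> complex" where
  "cinner \<Omega> u v = (\<Sum>x\<in>\<Omega>. u x * cnj (v x))"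

lemma cinner_linear:
  "cinner \<Omega> (u + v) w = cinner \<Omega> u w + cinner \<Omega> v w"
  "cinner \<Omega> (u - v) w = cinner \<Omega> u w - cinner \<Omega> v w"
  "cinner \<Omega> (cscale c u) w = c * cinner \<Omega> u w"
  "cinner \<Omega> w (cscale c u) = cnj c * cinner \<Omega> w u"
  "cinner \<Omega> 0 w = 0"
  by (simp_all add: cinner_def cscale_def algebra_simps sum.distrib sum_subtractf sum_distrib_left)

lemma cinner_sum: "cinner \<Omega> (\<Sum>s\<in>I. F s) w = (\<Sum>s\<in>I. cinner \<Omega> (F s) w)"
  by (induction I rule: infinite_finite_induct)
    (simp_all only: cinner_linear sum.infinite sum.empty sum.insert not_False_eq_True)

lemma cinner_commute: "cinner \<Omega> v u = cnj (cinner \<Omega> u v)"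
  by (simp add: cinner_def mult.commute)

lemma cinner_self: "cinner \<Omega> u u = complex_of_real (\<Sum>x\<in>\<Omega>. (cmod (u x))\<^sup>2)"
  unfolding cinner_def of_real_sum by (simp only: complex_norm_square)

definition orthonormal :: "'a set \<Rightarrow> ('a \<Rightarrow> complex) set \<Rightarrow> bool" where
  "orthonormal \<Omega> B \<longleftrightarrow> (\<forall>u\<in>B. \<forall>v\<in>B. cinner \<Omega> u v = (if u = v then 1 else 0))"

lemma orthonormal_coefficient:
  assumes "orthonormal \<Omega> B" "finite B" "b \<in> B"
  shows "cinner \<Omega> (\<Sum>x\<in>B. cscale (c x) x) b = c b"
proof -
  have "cinner \<Omega> (\<Sum>x\<in>B. cscale (c x) x) b = (\<Sum>x\<in>B. c x * (if x = b then 1 else 0))"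
    unfolding cinner_sum cinner_linear
    by (rule sum.cong) (use assms in \<open>auto simp: orthonormal_def\<close>)
  also have "\<dots> = c b" using assms by (simp add: if_distrib sum.delta cong: if_cong)
  finally show ?thesis .
qed

lemma orthonormal_independent:
  assumes "orthonormal \<Omega> B" "finite B"
  shows "cv.independent B"
proof (rule cv.independent_if_scalars_zero[OF assms(2)])
  fix f b assume "(\<Sum>x\<in>B. cscale (f x) x) = 0" "b \<in> B"
  then show "f b = 0"
    using orthonormal_coefficient[OF assms, of b f] by (simp add: cinner_linear)
qed

text \<open>Take an orthonormal subset of \<open>U\<close> of largest size; sizes are bounded
  because orthonormal sets are independent. If some vector differed from its Fourier expansion, the
  normalised difference could be added.\<close>

lemma orthonormal_basis_exists:
  assumes fin: "finite \<Omega>" and U: "csubspace U" "U \<subseteq> cvectors \<Omega>"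
  shows "\<exists>B. finite B \<and> B \<subseteq> U \<and> orthonormal \<Omega> B \<and> card B = cdim U \<and>
    (\<forall>u\<in>U. u = (\<Sum>b\<in>B. cscale (cinner \<Omega> u b) b))"
proof -
  let ?P = "\<lambda>B. finite B \<and> B \<subseteq> U \<and> orthonormal \<Omega> B"
  obtain W where W: "finite W" "card W \<le> card \<Omega>" "cvectors \<Omega> \<subseteq> cv.span W"
    using cvectors_span[OF fin] by blast
  have bound: "\<forall>B. ?P B \<longrightarrow> card B < Suc (card \<Omega>)"
  proof (intro allI impI)
    fix B assume B: "?P B"
    then have "cv.independent B" "B \<subseteq> cv.span W"
      using orthonormal_independent W(3) U(2) by blast+
    then have "card B \<le> card W" using cv.independent_span_bound[OF W(1)] by blast
    then show "card B < Suc (card \<Omega>)" using W(2) by simp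
  qed
  have "?P {}" by (simp add: orthonormal_def)
  then obtain B where B: "?P B" and Bmax: "\<And>B'. ?P B' \<Longrightarrow> card B' \<le> card B"
    using ex_has_greatest_nat[of ?P "{}" card] bound by (metis (no_types, lifting))
  have exp: "u = (\<Sum>b\<in>B. cscale (cinner \<Omega> u b) b)" if u: "u \<in> U" for u
  proof (rule ccontr)
    assume neq: "u \<noteq> (\<Sum>b\<in>B. cscale (cinner \<Omega> u b) b)"
    define w where "w = u - (\<Sum>b\<in>B. cscale (cinner \<Omega> u b) b)"
    have wU: "w \<in> U" unfolding w_def using B u
      by (intro cv.subspace_diff[OF U(1)] cv.subspace_sum[OF U(1)] cv.subspace_scale[OF U(1)]) auto
    have worth: "cinner \<Omega> w b = 0" if "b \<in> B" for b
      unfolding w_def cinner_linear using orthonormal_coefficient[of \<Omega> B b "cinner \<Omega> u"] B that by simp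
    define r where "r = (\<Sum>x\<in>\<Omega>. (cmod (w x))\<^sup>2)"
    have "r \<noteq> 0"
    proof
      assume "r = 0"
      then have "\<forall>x\<in>\<Omega>. w x = 0" unfolding r_def using fin by (subst (asm) sum_nonneg_eq_0_iff) auto
      then have "w = 0" using wU U(2) by (auto simp: cvectors_def fun_eq_iff)
      then show False using neq by (simp add: w_def)
    qed
    then have rpos: "r > 0" unfolding r_def by (metis less_le sum_nonneg zero_le_power2)
    define e where "e = cscale (complex_of_real (1 / sqrt r)) w"
    have eU: "e \<in> U" unfolding e_def by (rule cv.subspace_scale[OF U(1) wU])
    have "cinner \<Omega> w w = complex_of_real r" by (simp only: cinner_self r_def)
    then have "cinner \<Omega> e e = complex_of_real (1 / sqrt r) * complex_of_real (1 / sqrt r) * complex_of_real r"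
      by (simp add: e_def cinner_linear)
    also have "\<dots> = complex_of_real (1 / sqrt r * (1 / sqrt r) * r)" by (simp only: of_real_mult)
    also have "1 / sqrt r * (1 / sqrt r) * r = 1" using rpos by (simp add: field_simps)
    finally have ee: "cinner \<Omega> e e = 1" by simp
    have eb: "cinner \<Omega> e b = 0" if "b \<in> B" for b using worth[OF that] by (simp add: e_def cinner_linear)
    have be: "cinner \<Omega> b e = 0" if "b \<in> B" for b using eb[OF that] by (subst cinner_commute) simp
    have enB: "e \<notin> B" using eb[of e] ee by auto
    have "?P (insert e B)" using B eU ee eb be enB by (auto simp: orthonormal_def)
    then show False using Bmax[of "insert e B"] B enB by simp
  qed
  have "U \<subseteq> cv.span B"
  proof
    fix u assume "u \<in> U"
    then have "u = (\<Sum>b\<in>B. cscale (cinner \<Omega> u b) b)" by (rule exp)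
    also have "\<dots> \<in> cv.span B" by (intro cv.span_sum cv.span_scale cv.span_base)
    finally show "u \<in> cv.span B" .
  qed
  then have "card B = cdim U"
    using cv.basis_card_eq_dim[of B U] orthonormal_independent[of \<Omega> B] B by auto
  then show ?thesis using B exp by blast
qed

text \<open>\<open>E\<close> is the sum of the outer products of the basis vectors with their
  conjugates. Each of them has trace 1, which turns the dimension of \<open>U\<close> into a
  trace.\<close>

lemma orthogonal_projection_exists:
  assumes fin: "finite \<Omega>" and U: "csubspace U" "U \<subseteq> cvectors \<Omega>"
  shows "\<exists>E. supported \<Omega> E \<and> adjoint E = E \<and> (\<forall>u\<in>U. matvec \<Omega> E u = u) \<and>
    (\<forall>y. (\<lambda>x. E x y) \<in> U) \<and> tr \<Omega> E = of_nat (cdim U)"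
proof -
  obtain B where B: "finite B" "B \<subseteq> U" "orthonormal \<Omega> B" "card B = cdim U"
    and exp: "\<And>u. u \<in> U \<Longrightarrow> u = (\<Sum>b\<in>B. cscale (cinner \<Omega> u b) b)"
    using orthonormal_basis_exists[OF assms] by blast
  define E where "E x y = (\<Sum>b\<in>B. b x * cnj (b y))" for x y
  have sum_app: "(\<Sum>b\<in>B. cscale (c b) b) x = (\<Sum>b\<in>B. c b * b x)" for c x
    using B(1) by (induction B rule: finite_induct) (auto simp: cscale_def)
  have zero: "b x = 0" if "b \<in> B" "x \<notin> \<Omega>" for b x
    using that B(2) U(2) by (auto simp: cvectors_def)
  have "supported \<Omega> E" using zero by (auto simp: supported_def E_def intro!: sum.neutral)
  moreover have "adjoint E = E" by (simp add: fun_eq_iff adjoint_def E_def mult.commute)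
  moreover have "matvec \<Omega> E u = u" if "u \<in> U" for u
  proof
    fix x
    show "matvec \<Omega> E u x = u x"
    proof (cases "x \<in> \<Omega>")
      case True
      have "matvec \<Omega> E u x = (\<Sum>y\<in>\<Omega>. \<Sum>b\<in>B. b x * cnj (b y) * u y)"
        using True by (simp add: matvec_def E_def sum_distrib_right)
      also have "\<dots> = (\<Sum>b\<in>B. \<Sum>y\<in>\<Omega>. b x * cnj (b y) * u y)" by (rule sum.swap)
      also have "\<dots> = (\<Sum>b\<in>B. cinner \<Omega> u b * b x)"
        by (simp add: cinner_def sum_distrib_left sum_distrib_right algebra_simps)
      also have "\<dots> = u x" using exp[OF that] sum_app by metis
      finally show ?thesis .
    next
      case False
      then show ?thesis using that U(2) by (auto simp: matvec_def cvectors_def)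
    qed
  qed
  moreover have "(\<lambda>x. E x y) \<in> U" for y
  proof -
    have "(\<lambda>x. E x y) = (\<Sum>b\<in>B. cscale (cnj (b y)) b)"
      by (simp add: fun_eq_iff sum_app E_def mult.commute)
    also have "\<dots> \<in> U" using B
      by (intro cv.subspace_sum[OF U(1)] cv.subspace_scale[OF U(1)]) auto
    finally show ?thesis .
  qed
  moreover have "tr \<Omega> E = of_nat (cdim U)"
  proof -
    have "tr \<Omega> E = (\<Sum>b\<in>B. \<Sum>x\<in>\<Omega>. b x * cnj (b x))"
      unfolding tr_def E_def by (rule sum.swap)
    also have "\<dots> = (\<Sum>b\<in>B. 1)"
      by (rule sum.cong) (use B(3) in \<open>auto simp: orthonormal_def cinner_def\<close>)
    finally show ?thesis using B(4) by simp
  qed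
  ultimately show ?thesis by blast
qed

lemma sum_fun_apply2: "(\<Sum>s\<in>I. F s) x y = (\<Sum>s\<in>I. F s x y)" for F :: "'i \<Rightarrow> 'a \<Rightarrow> 'b \<Rightarrow> complex"
  by (induction I rule: infinite_finite_induct) auto

section \<open>The adjacency algebra\<close>

locale association_scheme =
  fixes \<Omega> :: "'a set" and S :: "('a \<times> 'a) set set"
  assumes scheme: "scheme \<Omega> S"
begin

abbreviation mm (infixl "\<odot>" 70) where "A \<odot> B \<equiv> mmult \<Omega> A B"

abbreviation alg :: "('a \<Rightarrow> 'a \<Rightarrow> complex) set" where "alg \<equiv> adjacency_algebra S"

lemma cc: "coherent_configuration \<Omega> S" and Id_in: "Id_on \<Omega> \<in> S"
  using scheme by (auto simp: scheme_def)

lemma finite_points: "finite \<Omega>"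
  and rel_nonempty: "s \<in> S \<Longrightarrow> s \<noteq> {}"
  and rel_subset: "s \<in> S \<Longrightarrow> s \<subseteq> \<Omega> \<times> \<Omega>"
  and rel_eqI: "\<lbrakk>r \<in> S; s \<in> S; p \<in> r; p \<in> s\<rbrakk> \<Longrightarrow> r = s"
  and rel_cover: "\<Union>S = \<Omega> \<times> \<Omega>"
  and converse_in: "s \<in> S \<Longrightarrow> s\<inverse> \<in> S"
proof -
  note cc' = cc[unfolded coherent_configuration_def]
  show "finite \<Omega>" "\<Union>S = \<Omega> \<times> \<Omega>" using cc' by simp_all
  show "s \<in> S \<Longrightarrow> s \<noteq> {}" "s \<in> S \<Longrightarrow> s \<subseteq> \<Omega> \<times> \<Omega>" "s \<in> S \<Longrightarrow> s\<inverse> \<in> S"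
    using cc' by simp_all
  show "\<lbrakk>r \<in> S; s \<in> S; p \<in> r; p \<in> s\<rbrakk> \<Longrightarrow> r = s"
    using cc' by (metis IntI empty_iff)
qed

lemma cnt_eq:
  assumes "r \<in> S" "s \<in> S" "t \<in> S" "(x, y) \<in> t" "(x', y') \<in> t"
  shows "cnt r s x y = cnt r s x' y'"
proof -
  have "\<forall>r\<in>S. \<forall>s\<in>S. \<forall>t\<in>S. \<forall>p\<in>t. \<forall>q\<in>t.
      cnt r s (fst p) (snd p) = cnt r s (fst q) (snd q)"
    using cc unfolding coherent_configuration_def by (elim conjE)
  from this[rule_format, OF assms] show ?thesis by simp
qed

lemma finite_rels: "finite S"
  by (rule finite_subset[of _ "Pow (\<Omega> \<times> \<Omega>)"]) (use rel_subset finite_points in auto)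

lemma finite_rel: "s \<in> S \<Longrightarrow> finite s"
  using rel_subset finite_points by (meson finite_SigmaI finite_subset)

lemma card_rel_pos: "s \<in> S \<Longrightarrow> card s > 0"
  using finite_rel rel_nonempty by (simp add: card_gt_0_iff)

lemma points_nonempty: "\<Omega> \<noteq> {}"
  using rel_nonempty[OF Id_in] by auto

lemma comb_apply:
  assumes "t \<in> S" "(x, y) \<in> t"
  shows "(\<Sum>s\<in>S. c s * adj s x y) = c t"
proof -
  have "(x, y) \<in> s \<longleftrightarrow> s = t" if "s \<in> S" for s
    using rel_eqI[OF that assms(1) _ assms(2)] assms(2) by blast
  then have "(\<Sum>s\<in>S. c s * adj s x y) = (\<Sum>s\<in>S. if s = t then c s else 0)"
    by (intro sum.cong) (simp_all add: adj_def)
  also have "\<dots> = c t" using assms(1) finite_rels by (simp add: sum.delta)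
  finally show ?thesis .
qed

lemma comb_outside: "(x, y) \<notin> \<Omega> \<times> \<Omega> \<Longrightarrow> (\<Sum>s\<in>S. c s * adj s x y) = 0"
  by (rule sum.neutral) (use rel_subset in \<open>auto simp: adj_def\<close>)

text \<open>The coefficient of \<open>adj s\<close> is the common value on \<open>s\<close>.
  Membership thus becomes a pointwise condition without a choice of coefficients.\<close>

lemma alg_iff:
  "M \<in> alg \<longleftrightarrow> supported \<Omega> M \<and>
    (\<forall>t\<in>S. \<forall>x y x' y'. (x, y) \<in> t \<longrightarrow> (x', y') \<in> t \<longrightarrow> M x y = M x' y')" (is "_ \<longleftrightarrow> ?R")
proof
  assume "M \<in> alg"
  then obtain c where "M = (\<lambda>x y. \<Sum>s\<in>S. c s * adj s x y)" by (auto simp: adjacency_algebra_def)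
  then show ?R using comb_apply comb_outside by (simp add: supported_def)
next
  assume R: ?R
  define c where "c s = (let p = (SOME p. p \<in> s) in M (fst p) (snd p))" for s
  have "M x y = (\<Sum>s\<in>S. c s * adj s x y)" for x y
  proof (cases "(x, y) \<in> \<Omega> \<times> \<Omega>")
    case True
    then obtain t where t: "t \<in> S" "(x, y) \<in> t" using rel_cover by blast
    have "(SOME p. p \<in> t) \<in> t" using t(2) by (rule someI)
    then have "c t = M x y" using R t unfolding c_def Let_def by (metis prod.collapse)
    then show ?thesis using comb_apply[OF t] by simp
  next
    case False
    then show ?thesis using R comb_outside by (auto simp: supported_def)
  qed
  then have "M = (\<lambda>x y. \<Sum>s\<in>S. c s * adj s x y)" by blast
  then show "M \<in> alg" unfolding adjacency_algebra_def by blast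
qed

lemma alg_supported: "M \<in> alg \<Longrightarrow> supported \<Omega> M"
  by (simp add: alg_iff)

lemma alg_const: "\<lbrakk>M \<in> alg; t \<in> S; (x, y) \<in> t; (x', y') \<in> t\<rbrakk> \<Longrightarrow> M x y = M x' y'"
  unfolding alg_iff by blast

lemma algI:
  "\<lbrakk>supported \<Omega> M; \<And>t x y x' y'. \<lbrakk>t \<in> S; (x, y) \<in> t; (x', y') \<in> t\<rbrakk> \<Longrightarrow> M x y = M x' y'\<rbrakk> \<Longrightarrow> M \<in> alg"
  unfolding alg_iff by blast

lemma alg_add:
  assumes "A \<in> alg" "B \<in> alg" shows "A + B \<in> alg"
proof (rule algI)
  show "supported \<Omega> (A + B)" using assms[THEN alg_supported] by (auto simp: supported_def)
  fix t x y x' y' assume t: "t \<in> S" "(x, y) \<in> t" "(x', y') \<in> t"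
  show "(A + B) x y = (A + B) x' y'"
    using alg_const[OF assms(1) t] alg_const[OF assms(2) t] by simp
qed

lemma alg_diff:
  assumes "A \<in> alg" "B \<in> alg" shows "A - B \<in> alg"
proof (rule algI)
  show "supported \<Omega> (A - B)" using assms[THEN alg_supported] by (auto simp: supported_def)
  fix t x y x' y' assume t: "t \<in> S" "(x, y) \<in> t" "(x', y') \<in> t"
  show "(A - B) x y = (A - B) x' y'"
    using alg_const[OF assms(1) t] alg_const[OF assms(2) t] by simp
qed

lemma alg_scale:
  assumes "A \<in> alg" shows "mscale c A \<in> alg"
proof (rule algI)
  show "supported \<Omega> (mscale c A)" using assms[THEN alg_supported] by (auto simp: supported_def mscale_def)
  fix t x y x' y' assume t: "t \<in> S" "(x, y) \<in> t" "(x', y') \<in> t"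
  show "mscale c A x y = mscale c A x' y'"
    using alg_const[OF assms(1) t] by (simp add: mscale_def)
qed

lemma alg_zero: "0 \<in> alg"
  by (auto simp: alg_iff supported_def)

lemma alg_sum: "(\<And>i. i \<in> I \<Longrightarrow> F i \<in> alg) \<Longrightarrow> (\<Sum>i\<in>I. F i) \<in> alg"
proof (induction I rule: infinite_finite_induct)
  case (insert i I)
  show ?case unfolding sum.insert[OF insert.hyps]
    by (rule alg_add) (use insert in blast)+
qed (simp_all only: sum.infinite sum.empty alg_zero not_False_eq_True)

lemma alg_adj: "s \<in> S \<Longrightarrow> adj s \<in> alg"
proof (rule algI)
  assume s: "s \<in> S"
  then show "supported \<Omega> (adj s)" using rel_subset by (auto simp: adj_def supported_def)
  fix t x y x' y' assume t: "t \<in> S" "(x, y) \<in> t" "(x', y') \<in> t"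
  then have "(x, y) \<in> s \<longleftrightarrow> (x', y') \<in> s"
    using rel_eqI[OF t(1) s t(2)] rel_eqI[OF t(1) s t(3)] by blast
  then show "adj s x y = adj s x' y'" by (simp add: adj_def)
qed

lemma alg_comb: "M \<in> alg \<Longrightarrow> \<exists>c. M = (\<Sum>s\<in>S. mscale (c s) (adj s))"
  unfolding adjacency_algebra_def fun_eq_iff sum_fun_apply2 mscale_def by blast

lemma alg_span: "M \<in> alg \<Longrightarrow> M \<in> mv.span (adj ` S)"
proof -
  assume "M \<in> alg"
  then obtain c where "M = (\<Sum>s\<in>S. mscale (c s) (adj s))" using alg_comb by blast
  also have "\<dots> \<in> mv.span (adj ` S)" by (intro mv.span_sum mv.span_scale mv.span_base imageI)
  finally show ?thesis .
qed

lemma adj_converse: "adj (s\<inverse>) x y = adj s y x"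
  by (simp add: adj_def)

lemma alg_adjoint:
  assumes "A \<in> alg" shows "adjoint A \<in> alg"
  unfolding alg_iff
proof (intro conjI ballI allI impI)
  show "supported \<Omega> (adjoint A)"
    using assms by (auto simp: alg_iff supported_def adjoint_def)
next
  fix t x y x' y' assume "t \<in> S" "(x, y) \<in> t" "(x', y') \<in> t"
  then have "t\<inverse> \<in> S" "(y, x) \<in> t\<inverse>" "(y', x') \<in> t\<inverse>" using converse_in by auto
  then have "A y x = A y' x'" using assms unfolding alg_iff by blast
  then show "adjoint A x y = adjoint A x' y'" by (simp add: adjoint_def)
qed

lemma adj_mult_apply:
  assumes "r \<in> S"
  shows "(adj r \<odot> adj s) x y = of_nat (cnt r s x y)"
proof -
  have "(adj r \<odot> adj s) x y = (\<Sum>z\<in>\<Omega>. if (x, z) \<in> r \<and> (z, y) \<in> s then 1 else 0)"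
    unfolding mmult_def by (rule sum.cong) (auto simp: adj_def)
  also have "\<dots> = of_nat (card {z \<in> \<Omega>. (x, z) \<in> r \<and> (z, y) \<in> s})"
    using finite_points by (simp add: sum.If_cases Int_def)
  also have "{z \<in> \<Omega>. (x, z) \<in> r \<and> (z, y) \<in> s} = {b. (x, b) \<in> r \<and> (b, y) \<in> s}"
    using rel_subset[OF assms] by auto
  finally show ?thesis by (simp add: cnt_def)
qed

text \<open>The entries of the product count paths of length two, so their constancy on relations is
  the coherence axiom.\<close>

lemma alg_adj_mult:
  assumes "r \<in> S" "s \<in> S"
  shows "adj r \<odot> adj s \<in> alg"
  unfolding alg_iff
proof (intro conjI ballI allI impI)
  show "supported \<Omega> (adj r \<odot> adj s)"
    using rel_subset[OF assms(1)] rel_subset[OF assms(2)]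
    by (auto simp: supported_def mmult_def adj_def intro!: sum.neutral)
next
  fix t x y x' y' assume t: "t \<in> S" "(x, y) \<in> t" "(x', y') \<in> t"
  show "(adj r \<odot> adj s) x y = (adj r \<odot> adj s) x' y'"
    using cnt_eq[OF assms t] by (simp add: adj_mult_apply assms)
qed

lemma alg_mult:
  assumes "A \<in> alg" "B \<in> alg"
  shows "A \<odot> B \<in> alg"
proof -
  obtain c d where "A = (\<Sum>s\<in>S. mscale (c s) (adj s))" "B = (\<Sum>s\<in>S. mscale (d s) (adj s))"
    using alg_comb assms by blast
  then show ?thesis
    by (auto simp only: mmult_sum mmult_linear intro!: alg_sum alg_scale alg_adj_mult)
qed

abbreviation One :: "'a \<Rightarrow> 'a \<Rightarrow> complex" where "One \<equiv> adj (Id_on \<Omega>)"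

lemma One_mult:
  assumes "supported \<Omega> M"
  shows "One \<odot> M = M" "M \<odot> One = M"
proof -
  show "One \<odot> M = M"
  proof (intro ext)
    fix x y
    have "(One \<odot> M) x y = (\<Sum>z\<in>\<Omega>. if z = x then M z y else 0)"
      unfolding mmult_def by (rule sum.cong) (auto simp: adj_def)
    then show "(One \<odot> M) x y = M x y"
      using assms finite_points by (simp add: supported_def)
  qed
  show "M \<odot> One = M"
  proof (intro ext)
    fix x y
    have "(M \<odot> One) x y = (\<Sum>z\<in>\<Omega>. if z = y then M x z else 0)"
      unfolding mmult_def by (rule sum.cong) (auto simp: adj_def)
    then show "(M \<odot> One) x y = M x y"
      using assms finite_points by (simp add: supported_def)
  qed
qed

lemma tr_adj_converse:
  assumes "s \<in> S"
  shows "tr \<Omega> (X \<odot> adj (s\<inverse>)) = (\<Sum>p\<in>s. X (fst p) (snd p))"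
proof -
  have "tr \<Omega> (X \<odot> adj (s\<inverse>)) = (\<Sum>p\<in>\<Omega> \<times> \<Omega>. X (fst p) (snd p) * adj s (fst p) (snd p))"
    unfolding tr_def mmult_def adj_converse by (simp add: sum.cartesian_product split_def)
  also have "\<dots> = (\<Sum>p\<in>s. X (fst p) (snd p) * adj s (fst p) (snd p))"
    using rel_subset[OF assms] finite_points
    by (intro sum.mono_neutral_right) (auto simp: adj_def)
  also have "\<dots> = (\<Sum>p\<in>s. X (fst p) (snd p))"
    by (rule sum.cong) (auto simp: adj_def)
  finally show ?thesis .
qed

text \<open>With respect to the trace form the matrices \<open>adj (s\<inverse>) / card s\<close>
  are the dual basis of the matrices \<open>adj s\<close>, since
  \<open>tr \<Omega> (adj r \<odot> adj (s\<inverse>))\<close> is the size of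
  \<open>r \<inter> s\<close>. Hence the coefficients are traces.\<close>

lemma alg_expansion:
  assumes "X \<in> alg"
  shows "X = (\<Sum>s\<in>S. mscale (tr \<Omega> (X \<odot> adj (s\<inverse>)) / of_nat (card s)) (adj s))" (is "_ = ?Y")
proof (intro ext)
  fix x y
  show "X x y = ?Y x y"
  proof (cases "(x, y) \<in> \<Omega> \<times> \<Omega>")
    case True
    then obtain t where t: "t \<in> S" "(x, y) \<in> t" using rel_cover by blast
    have "(\<Sum>p\<in>t. X (fst p) (snd p)) = (\<Sum>p\<in>t. X x y)"
    proof (rule sum.cong[OF refl])
      fix p assume "p \<in> t"
      then show "X (fst p) (snd p) = X x y" using alg_const[OF assms t(1) _ t(2)] by (cases p) simp
    qed
    then have "tr \<Omega> (X \<odot> adj (t\<inverse>)) / of_nat (card t) = X x y"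
      using tr_adj_converse[OF t(1)] card_rel_pos[OF t(1)] by simp
    then show ?thesis unfolding sum_fun_apply2 mscale_def comb_apply[OF t] by simp
  next
    case False
    then show ?thesis using alg_supported[OF assms]
      unfolding sum_fun_apply2 mscale_def comb_outside[OF False] by (auto simp: supported_def)
  qed
qed

lemma bij_converse: "bij_betw converse S S"
  by (rule bij_betwI[where g = converse]) (auto intro: converse_in)

lemma sum_converse: "(\<Sum>s\<in>S. f (s\<inverse>)) = (\<Sum>s\<in>S. f s)"
  using sum.reindex_bij_betw[OF bij_converse] .

text \<open>The expansion needed for the factor to the right of \<open>B\<close> in
  \<open>average_commute\<close>.\<close>

lemma alg_expansion_converse:
  assumes "X \<in> alg"
  shows "X = (\<Sum>s\<in>S. mscale (tr \<Omega> (X \<odot> adj s) / of_nat (card s)) (adj (s\<inverse>)))"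
  using alg_expansion[OF assms]
    sum_converse[of "\<lambda>s. mscale (tr \<Omega> (X \<odot> adj (s\<inverse>)) / of_nat (card s)) (adj s)"]
  by simp

text \<open>Nondegeneracy of the trace form: identities in the algebra can be proved for elements
  that are known only through traces.\<close>

lemma alg_eq_0:
  assumes "X \<in> alg" "\<And>Y. Y \<in> alg \<Longrightarrow> tr \<Omega> (X \<odot> Y) = 0"
  shows "X = 0"
proof -
  have "(\<Sum>s\<in>S. mscale (tr \<Omega> (X \<odot> adj (s\<inverse>)) / of_nat (card s)) (adj s)) = (\<Sum>s\<in>S. 0)"
    by (rule sum.cong) (use assms alg_adj converse_in in auto)
  then show ?thesis using alg_expansion[OF assms(1)] by simp
qed

section \<open>Averaging over dual bases, the Casimir element and the centre\<close>

definition average :: "('a \<Rightarrow> 'a \<Rightarrow> complex) \<Rightarrow> 'a \<Rightarrow> 'a \<Rightarrow> complex" where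
  "average B = (\<Sum>s\<in>S. mscale (1 / of_nat (card s)) (adj s \<odot> B \<odot> adj (s\<inverse>)))"

text \<open>The analogue of averaging over a group by conjugation, the basis \<open>adj s\<close>
  and its trace-dual basis replacing the group elements and their inverses; \<open>B\<close> is
  arbitrary. By cyclicity of the trace, the coefficient of \<open>adj t\<close> in
  \<open>X \<odot> adj s\<close> equals, up to the weights, that of \<open>adj (s\<inverse>)\<close>
  in \<open>adj (t\<inverse>) \<odot> X\<close>, so \<open>X\<close> passes from left to right when
  the two sums are exchanged.\<close>

lemma average_commute:
  assumes X: "X \<in> alg"
  shows "X \<odot> average B = average B \<odot> X"
proof -
  let ?w = "\<lambda>s. 1 / of_nat (card s) :: complex"
  let ?G = "\<lambda>s t. mscale (?w s * ?w t * tr \<Omega> (X \<odot> adj s \<odot> adj (t\<inverse>))) (adj t \<odot> B \<odot> adj (s\<inverse>))"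
  have "X \<odot> average B = (\<Sum>s\<in>S. mscale (?w s) ((X \<odot> adj s) \<odot> B \<odot> adj (s\<inverse>)))"
    unfolding average_def by (simp add: mmult_sum mmult_linear mmult_assoc)
  also have "\<dots> = (\<Sum>s\<in>S. \<Sum>t\<in>S. ?G s t)"
  proof (rule sum.cong[OF refl])
    fix s assume "s \<in> S"
    then have "X \<odot> adj s \<in> alg" using X alg_adj alg_mult by blast
    from alg_expansion[OF this]
    have "(X \<odot> adj s) \<odot> B \<odot> adj (s\<inverse>) =
      (\<Sum>t\<in>S. mscale (tr \<Omega> (X \<odot> adj s \<odot> adj (t\<inverse>)) / of_nat (card t)) (adj t)) \<odot> B \<odot> adj (s\<inverse>)"
      by presburger
    then show "mscale (?w s) ((X \<odot> adj s) \<odot> B \<odot> adj (s\<inverse>)) = (\<Sum>t\<in>S. ?G s t)"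
      by (simp add: mmult_sum mmult_linear mv.scale_sum_right)
  qed
  also have "\<dots> = (\<Sum>t\<in>S. \<Sum>s\<in>S. ?G s t)" by (rule sum.swap)
  also have "\<dots> = (\<Sum>t\<in>S. mscale (?w t) (adj t \<odot> B \<odot> (adj (t\<inverse>) \<odot> X)))"
  proof (rule sum.cong[OF refl])
    fix t assume "t \<in> S"
    then have "adj (t\<inverse>) \<odot> X \<in> alg" using X alg_adj alg_mult converse_in by blast
    from alg_expansion_converse[OF this]
    have "adj t \<odot> B \<odot> (adj (t\<inverse>) \<odot> X) = adj t \<odot> B \<odot>
      (\<Sum>s\<in>S. mscale (tr \<Omega> (adj (t\<inverse>) \<odot> X \<odot> adj s) / of_nat (card s)) (adj (s\<inverse>)))"
      by presburger
    moreover have "tr \<Omega> (adj (t\<inverse>) \<odot> X \<odot> adj s) = tr \<Omega> (X \<odot> adj s \<odot> adj (t\<inverse>))" for s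
      by (metis mmult_assoc tr_mmult_commute)
    ultimately show "(\<Sum>s\<in>S. ?G s t) = mscale (?w t) (adj t \<odot> B \<odot> (adj (t\<inverse>) \<odot> X))"
      by (simp add: mmult_sum mmult_linear mv.scale_sum_right mult.commute)
  qed
  also have "\<dots> = average B \<odot> X"
    unfolding average_def by (simp add: mmult_sum mmult_linear mmult_assoc)
  finally show ?thesis .
qed

definition casimir :: "'a \<Rightarrow> 'a \<Rightarrow> complex" where
  "casimir = (\<Sum>s\<in>S. mscale (1 / of_nat (card s)) (adj s \<odot> adj (s\<inverse>)))"

definition central :: "('a \<Rightarrow> 'a \<Rightarrow> complex) \<Rightarrow> bool" where
  "central Z \<longleftrightarrow> Z \<in> alg \<and> (\<forall>M\<in>alg. Z \<odot> M = M \<odot> Z)"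

lemma central_alg: "central Z \<Longrightarrow> Z \<in> alg" and
  central_commute: "central Z \<Longrightarrow> M \<in> alg \<Longrightarrow> Z \<odot> M = M \<odot> Z"
  by (auto simp: central_def)

lemma central_casimir: "central casimir"
proof -
  have eq: "casimir = average One"
    unfolding casimir_def average_def
    by (rule sum.cong) (simp_all add: One_mult alg_supported alg_adj)
  have "casimir \<in> alg"
    unfolding casimir_def by (intro alg_sum alg_scale alg_mult alg_adj converse_in)
  then show ?thesis by (metis average_commute central_def eq)
qed

text \<open>Cyclicity brings both factors to one side of \<open>B\<close>, in the order
  \<open>adj (s\<inverse>)\<close>, \<open>adj s\<close>. Reindexing by the converse, which
  preserves \<open>card s\<close>, restores the order in \<open>casimir\<close>.\<close>

lemma tr_average: "tr \<Omega> (average B) = tr \<Omega> (B \<odot> casimir)"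
proof -
  have "tr \<Omega> (average B) = (\<Sum>s\<in>S. 1 / of_nat (card s) * tr \<Omega> (B \<odot> (adj (s\<inverse>) \<odot> adj s)))"
    unfolding average_def tr_sum tr_linear
    by (intro sum.cong refl) (metis mmult_assoc tr_mmult_commute)
  also have "\<dots> = (\<Sum>s\<in>S. 1 / of_nat (card s) * tr \<Omega> (B \<odot> (adj s \<odot> adj (s\<inverse>))))"
    using sum_converse[of "\<lambda>s. 1 / of_nat (card s) * tr \<Omega> (B \<odot> (adj s \<odot> adj (s\<inverse>)))"] by simp
  also have "\<dots> = tr \<Omega> (B \<odot> casimir)"
    unfolding casimir_def mmult_sum mmult_linear tr_sum tr_linear ..
  finally show ?thesis .
qed

lemma central_add: "central A \<Longrightarrow> central B \<Longrightarrow> central (A + B)"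
  and central_diff: "central A \<Longrightarrow> central B \<Longrightarrow> central (A - B)"
  and central_scale: "central A \<Longrightarrow> central (mscale c A)"
  by (simp_all only: central_def mmult_linear alg_add alg_diff alg_scale) metis+

lemma central_zero: "central 0"
  by (simp only: central_def mmult_linear alg_zero) blast

lemma central_sum: "(\<And>i. i \<in> I \<Longrightarrow> central (F i)) \<Longrightarrow> central (\<Sum>i\<in>I. F i)"
proof (induction I rule: infinite_finite_induct)
  case (insert i I)
  show ?case unfolding sum.insert[OF insert.hyps]
    by (rule central_add) (use insert in blast)+
qed (simp_all only: sum.infinite sum.empty central_zero not_False_eq_True)

lemma central_mult:
  assumes A: "central A" and B: "central B"
  shows "central (A \<odot> B)"
  unfolding central_def
proof (intro conjI ballI)
  show "A \<odot> B \<in> alg" using A B central_alg alg_mult by blast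
  fix M assume M: "M \<in> alg"
  have "A \<odot> B \<odot> M = A \<odot> (M \<odot> B)" by (simp only: mmult_assoc central_commute[OF B M])
  also have "\<dots> = M \<odot> A \<odot> B" by (simp only: mmult_assoc[symmetric] central_commute[OF A M])
  finally show "A \<odot> B \<odot> M = M \<odot> (A \<odot> B)" by (simp only: mmult_assoc)
qed

lemma central_One: "central One"
  unfolding central_def by (simp add: alg_adj Id_in One_mult alg_supported)

text \<open>A central element commutes with its adjoint, and a normal nilpotent matrix vanishes.\<close>

lemma central_square_zero:
  assumes "central Y" "Y \<odot> Y = 0"
  shows "Y = 0"
proof -
  let ?H = "adjoint Y \<odot> Y"
  have aY: "adjoint Y \<in> alg" using assms(1) alg_adjoint central_alg by blast
  have "?H \<odot> ?H = adjoint Y \<odot> (adjoint Y \<odot> (Y \<odot> Y))"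
    using central_commute[OF assms(1) aY] by (metis mmult_assoc)
  then have "tr \<Omega> (adjoint ?H \<odot> ?H) = 0"
    using assms(2) by (simp only: adjoint_mmult adjoint_adjoint mmult_linear tr_linear)
  then have "?H = 0"
    using adjoint_mmult_eq_0[OF finite_points alg_supported] aY assms(1) central_alg alg_mult by blast
  then have "tr \<Omega> ?H = 0" by (simp only: tr_linear)
  then show ?thesis
    using adjoint_mmult_eq_0[OF finite_points alg_supported] assms(1) central_alg by blast
qed

section \<open>Central primitive idempotents\<close>

abbreviation primitives :: "('a \<Rightarrow> 'a \<Rightarrow> complex) set" where
  "primitives \<equiv> central_primitive_idempotents \<Omega> S"

lemma central_idempotent_iff: "central_idempotent \<Omega> S P \<longleftrightarrow> central P \<and> P \<noteq> 0 \<and> P \<odot> P = P"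
  by (auto simp: central_idempotent_def central_def)

text \<open>Otherwise \<open>P = Q + (P - Q)\<close> would split \<open>P\<close> into two
  orthogonal central idempotents.\<close>

lemma primitive_absorb:
  assumes P: "P \<in> primitives" and Q: "central Q" "Q \<noteq> 0" "Q \<odot> Q = Q" "Q \<odot> P = Q"
  shows "Q = P"
proof (rule ccontr)
  assume "Q \<noteq> P"
  have cP: "central P" "P \<odot> P = P"
    using P by (auto simp: central_primitive_idempotents_def central_idempotent_iff)
  have PQ: "P \<odot> Q = Q" using central_commute[OF Q(1) central_alg[OF cP(1)]] Q(4) by simp
  let ?R = "P - Q"
  have "?R \<noteq> 0" using \<open>Q \<noteq> P\<close> by (metis eq_iff_diff_eq_0)
  moreover have "?R \<odot> ?R = ?R" using cP Q PQ by (simp only: mmult_linear) simp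
  moreover have "Q \<odot> ?R = 0" using Q by (simp only: mmult_linear) simp
  moreover have "P = Q + ?R" by simp
  ultimately show False
    using P Q cP central_diff unfolding central_primitive_idempotents_def central_idempotent_iff
    by blast
qed

text \<open>An eigenvector \<open>Y\<close> of multiplication by \<open>Z\<close> that is a polynomial in \<open>Z\<close> times \<open>P\<close>
  satisfies \<open>Y\<^sup>2 = \<kappa> Y\<close>; then \<open>\<kappa> \<noteq> 0\<close> and the idempotent \<open>Y / \<kappa>\<close> must be \<open>P\<close>.\<close>

lemma central_mult_primitive:
  assumes P: "P \<in> primitives" and Z: "central Z"
  shows "\<exists>\<mu>. Z \<odot> P = mscale \<mu> P"
proof -
  have cP: "central P" "P \<noteq> 0" "P \<odot> P = P"
    using P by (auto simp: central_primitive_idempotents_def central_idempotent_iff)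
  let ?T = "\<lambda>M. Z \<odot> M"
  have cpow: "central ((?T ^^ n) P)" for n
    by (induction n) (simp_all add: cP central_mult[OF Z])
  have powP: "(?T ^^ n) P \<odot> P = (?T ^^ n) P" for n
    by (induction n) (simp_all add: cP mmult_assoc)
  have "\<exists>n c a. (\<Sum>i\<le>n. mscale (c i) ((?T ^^ i) P)) \<noteq> 0 \<and>
     ?T (\<Sum>i\<le>n. mscale (c i) ((?T ^^ i) P)) = mscale a (\<Sum>i\<le>(n::nat). mscale (c i) ((?T ^^ i) P))"
  proof (rule cyclic_eigenvector[OF mv.vector_space_axioms])
    show "(?T ^^ n) P \<in> mv.span (adj ` S)" for n by (rule alg_span[OF central_alg[OF cpow]])
  qed (simp_all only: mmult_linear cP finite_rels finite_imageI not_False_eq_True)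
  then obtain n c a where *: "(\<Sum>i\<le>n. mscale (c i) ((?T ^^ i) P)) \<noteq> 0"
    "?T (\<Sum>i\<le>n. mscale (c i) ((?T ^^ i) P)) = mscale a (\<Sum>i\<le>(n::nat). mscale (c i) ((?T ^^ i) P))"
    by blast
  define Y where "Y = (\<Sum>i\<le>n. mscale (c i) ((?T ^^ i) P))"
  have Y: "Y \<noteq> 0" "Z \<odot> Y = mscale a Y" using * by (simp_all add: Y_def)
  have cY: "central Y" unfolding Y_def by (intro central_sum central_scale cpow)
  have YP: "Y \<odot> P = Y" unfolding Y_def by (simp add: mmult_sum mmult_linear powP)
  then have PY: "P \<odot> Y = Y" using central_commute[OF cP(1) central_alg[OF cY]] by simp
  have powY: "(?T ^^ i) P \<odot> Y = mscale (a ^ i) Y" for i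
    by (induction i) (simp_all add: PY mmult_assoc mmult_linear Y mult.commute)
  define \<kappa> where "\<kappa> = (\<Sum>i\<le>n. c i * a ^ i)"
  have "Y \<odot> Y = (\<Sum>i\<le>n. mscale (c i) ((?T ^^ i) P)) \<odot> Y" by (simp add: Y_def)
  also have "\<dots> = mscale \<kappa> Y"
    by (simp add: mmult_sum mmult_linear powY \<kappa>_def mv.scale_sum_left)
  finally have YY: "Y \<odot> Y = mscale \<kappa> Y" .
  then have \<kappa>: "\<kappa> \<noteq> 0" using central_square_zero[OF cY] Y(1) by auto
  define Q where "Q = mscale (1 / \<kappa>) Y"
  have "Q = P"
  proof (rule primitive_absorb[OF P])
    show "central Q" unfolding Q_def by (rule central_scale[OF cY])
    show "Q \<noteq> 0" using Y(1) \<kappa> by (simp add: Q_def)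
    show "Q \<odot> Q = Q" using \<kappa> by (simp add: Q_def mmult_linear YY)
    show "Q \<odot> P = Q" by (simp add: Q_def mmult_linear YP)
  qed
  moreover have "Z \<odot> Q = mscale a Q" by (simp add: Q_def mmult_linear Y mult.commute)
  ultimately show ?thesis by auto
qed

end

section \<open>Schur orthogonality\<close>

text \<open>Collects what later arguments use of the orthogonal projection; idempotence follows from
  the clauses on fixed vectors and columns.\<close>

definition projects_onto :: "'a set \<Rightarrow> ('a \<Rightarrow> 'a \<Rightarrow> complex) \<Rightarrow> ('a \<Rightarrow> complex) set \<Rightarrow> bool" where
  "projects_onto \<Omega> E U \<longleftrightarrow> supported \<Omega> E \<and> adjoint E = E \<and> (\<forall>u\<in>U. matvec \<Omega> E u = u) \<and>
    (\<forall>y. (\<lambda>x. E x y) \<in> U) \<and> tr \<Omega> E = of_nat (cdim U)"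

lemma projects_onto_mmult:
  assumes "projects_onto \<Omega> E U" "\<And>y. (\<lambda>x. M x y) \<in> U"
  shows "mmult \<Omega> E M = M"
proof (intro ext)
  fix x y
  have "(\<lambda>x. mmult \<Omega> E M x y) = (\<lambda>x. M x y)"
    using assms by (simp add: mmult_column projects_onto_def)
  then show "mmult \<Omega> E M x y = M x y" by (rule fun_cong)
qed

lemma projects_onto_idem: "projects_onto \<Omega> E U \<Longrightarrow> mmult \<Omega> E E = E"
  using projects_onto_mmult[of \<Omega> E U E] by (simp add: projects_onto_def)

lemma projects_onto_matvec:
  assumes E: "projects_onto \<Omega> E U" and U: "csubspace U"
  shows "matvec \<Omega> E v \<in> U"
proof -
  have app: "(\<Sum>y\<in>I. cscale (v y) (\<lambda>x. E x y)) x = (\<Sum>y\<in>I. v y * E x y)" for I x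
    by (induction I rule: infinite_finite_induct) (auto simp: cscale_def)
  have "matvec \<Omega> E v = (\<Sum>y\<in>\<Omega>. cscale (v y) (\<lambda>x. E x y))"
  proof
    fix x
    show "matvec \<Omega> E v x = (\<Sum>y\<in>\<Omega>. cscale (v y) (\<lambda>x. E x y)) x"
      using E unfolding app by (auto simp: matvec_def mult.commute projects_onto_def supported_def)
  qed
  also have "\<dots> \<in> U"
    using E by (intro cv.subspace_sum[OF U] cv.subspace_scale[OF U]) (simp add: projects_onto_def)
  finally show ?thesis .
qed

lemma projects_onto_dim_0:
  assumes "finite \<Omega>" and E: "projects_onto \<Omega> E U" and "cdim U = 0"
  shows "E = 0"
proof -
  have "tr \<Omega> (mmult \<Omega> (adjoint E) E) = 0"
    using E assms(3) projects_onto_idem[OF E] by (simp add: projects_onto_def)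
  then show ?thesis
    using adjoint_mmult_eq_0[OF assms(1)] E unfolding projects_onto_def by blast
qed

lemma csubspace_range: "csubspace (range (matvec \<Omega> P))"
proof (rule cv.subspaceI)
  have "matvec \<Omega> P 0 = 0" by (auto simp: matvec_def)
  then show "0 \<in> range (matvec \<Omega> P)" by (metis rangeI)
next
  fix x y assume "x \<in> range (matvec \<Omega> P)" "y \<in> range (matvec \<Omega> P)"
  then show "x + y \<in> range (matvec \<Omega> P)" by (auto simp only: matvec_linear(1)[symmetric] rangeI)
next
  fix c x assume "x \<in> range (matvec \<Omega> P)"
  then show "cscale c x \<in> range (matvec \<Omega> P)" by (auto simp only: matvec_linear(2)[symmetric] rangeI)
qed

lemma range_subset_cvectors: "range (matvec \<Omega> P) \<subseteq> cvectors \<Omega>"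
  by (auto simp: cvectors_def matvec_def)

text \<open>An idempotent need not be Hermitian, so it is compared with the orthogonal projection
  onto its range. Each of the two fixes the columns of the other, and by cyclicity they have the
  same trace; this is how \<open>tr_idempotent\<close> obtains the rank.\<close>

lemma idempotent_projection:
  assumes fin: "finite \<Omega>" and P: "supported \<Omega> P" "mmult \<Omega> P P = P"
  shows "\<exists>E. projects_onto \<Omega> E (range (matvec \<Omega> P)) \<and> mmult \<Omega> P E = E \<and> mmult \<Omega> E P = P"
proof -
  let ?U = "range (matvec \<Omega> P)"
  obtain E where E: "projects_onto \<Omega> E ?U"
    using orthogonal_projection_exists[OF fin csubspace_range range_subset_cvectors]
    unfolding projects_onto_def by blast
  have fixed: "matvec \<Omega> P u = u" if "u \<in> ?U" for u
    using that P(2) by (metis (no_types, lifting) imageE matvec_mmult)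
  have "mmult \<Omega> P E = E"
  proof (intro ext)
    fix x y
    have "(\<lambda>x. mmult \<Omega> P E x y) = matvec \<Omega> P (\<lambda>x. E x y)" by (rule mmult_column[OF P(1)])
    also have "\<dots> = (\<lambda>x. E x y)" using E unfolding projects_onto_def by (intro fixed) blast
    finally show "mmult \<Omega> P E x y = E x y" by (rule fun_cong)
  qed
  moreover have "mmult \<Omega> E P = P"
  proof (rule projects_onto_mmult[OF E])
    fix y
    have "(\<lambda>x. P x y) = matvec \<Omega> P (\<lambda>z. P z y)" using mmult_column[OF P(1), of P y] P(2) by simp
    then show "(\<lambda>x. P x y) \<in> ?U" by (metis rangeI)
  qed
  ultimately show ?thesis using E by blast
qed

lemma tr_idempotent:
  assumes "finite \<Omega>" "supported \<Omega> P" "mmult \<Omega> P P = P"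
  shows "tr \<Omega> P = of_nat (mat_rank \<Omega> P)"
proof -
  obtain E where E: "projects_onto \<Omega> E (range (matvec \<Omega> P))" "mmult \<Omega> P E = E" "mmult \<Omega> E P = P"
    using idempotent_projection[OF assms] by blast
  then have "tr \<Omega> P = tr \<Omega> E" using tr_mmult_commute[of \<Omega> P E] by simp
  then show ?thesis using E by (simp add: projects_onto_def mat_rank_def)
qed

lemma mat_rank_idempotent_pos:
  assumes "finite \<Omega>" "supported \<Omega> P" "mmult \<Omega> P P = P" "P \<noteq> 0"
  shows "mat_rank \<Omega> P > 0"
proof (rule ccontr)
  assume "\<not> mat_rank \<Omega> P > 0"
  then have 0: "cdim (range (matvec \<Omega> P)) = 0" by (simp add: mat_rank_def)
  obtain E where E: "projects_onto \<Omega> E (range (matvec \<Omega> P))" "mmult \<Omega> E P = P"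
    using idempotent_projection[OF assms(1-3)] by blast
  have "E = 0" by (rule projects_onto_dim_0[OF assms(1) E(1) 0])
  then have "P = 0" using E(2) mmult_linear(7) by metis
  then show False using assms(4) by blast
qed

context association_scheme
begin

lemma projection_exists:
  assumes "submodule \<Omega> S U"
  obtains E where "projects_onto \<Omega> E U"
  using assms orthogonal_projection_exists[OF finite_points]
  unfolding projects_onto_def submodule_def by blast

text \<open>Invariance of \<open>U\<close> gives \<open>E Y E = Y E\<close> for all \<open>Y\<close>
  in the algebra. For the adjoint of \<open>X\<close>, which is again in the algebra, this becomes
  \<open>E X E = E X\<close> after taking adjoints; the two identities together give the
  claim.\<close>

lemma projection_commute:
  assumes U: "submodule \<Omega> S U" and E: "projects_onto \<Omega> E U" and X: "X \<in> alg"
  shows "X \<odot> E = E \<odot> X"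
proof -
  have inv: "E \<odot> (Y \<odot> E) = Y \<odot> E" if Y: "Y \<in> alg" for Y
  proof (rule projects_onto_mmult[OF E])
    fix y
    have "(\<lambda>x. (Y \<odot> E) x y) = matvec \<Omega> Y (\<lambda>x. E x y)"
      by (rule mmult_column[OF alg_supported[OF Y]])
    also have "\<dots> \<in> U" using U E Y unfolding submodule_def projects_onto_def by blast
    finally show "(\<lambda>x. (Y \<odot> E) x y) \<in> U" .
  qed
  have aE: "adjoint E = E" using E by (simp add: projects_onto_def)
  have "adjoint (E \<odot> (adjoint X \<odot> E)) = adjoint (adjoint X \<odot> E)"
    using inv[OF alg_adjoint[OF X]] by simp
  then have "E \<odot> X \<odot> E = E \<odot> X" by (simp only: adjoint_mmult adjoint_adjoint aE)
  then show ?thesis using inv[OF X] by (simp only: mmult_assoc)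
qed

lemma submodule_dim_nonzero:
  assumes U: "submodule \<Omega> S U" "U \<noteq> {0}" and E: "projects_onto \<Omega> E U"
  shows "cdim U \<noteq> 0"
proof
  assume "cdim U = 0"
  then have "E = 0" by (rule projects_onto_dim_0[OF finite_points E])
  then have "matvec \<Omega> E u = 0" for u by (auto simp: matvec_def)
  then have "u = 0" if "u \<in> U" for u using E that by (metis projects_onto_def)
  moreover have "0 \<in> U" using U(1) cv.subspace_0 by (auto simp: submodule_def)
  ultimately show False using U(2) by blast
qed

lemma irreducible_exists:
  assumes U0: "submodule \<Omega> S U0" "U0 \<noteq> {0}"
  shows "\<exists>U. irreducible_submodule \<Omega> S U \<and> U \<subseteq> U0"
proof -
  obtain U where U: "submodule \<Omega> S U" "U \<noteq> {0}" "U \<subseteq> U0"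
    and min: "\<And>W. submodule \<Omega> S W \<Longrightarrow> W \<noteq> {0} \<Longrightarrow> W \<subseteq> U0 \<Longrightarrow> cdim U \<le> cdim W"
    using ex_has_least_nat[of "\<lambda>U. submodule \<Omega> S U \<and> U \<noteq> {0} \<and> U \<subseteq> U0" U0 cdim] U0 by blast
  have "W = U" if W: "submodule \<Omega> S W" "W \<subseteq> U" "W \<noteq> {0}" for W
  proof -
    obtain E where E: "projects_onto \<Omega> E U" using projection_exists U(1) by blast
    obtain F where F: "projects_onto \<Omega> F W" using projection_exists W(1) by blast
    have EF: "E \<odot> F = F"
      using F W(2) by (intro projects_onto_mmult[OF E]) (auto simp: projects_onto_def)
    have aE: "adjoint E = E" and aF: "adjoint F = F" using E F by (simp_all add: projects_onto_def)
    have FE: "F \<odot> E = F" using arg_cong[OF EF, of adjoint] by (simp only: adjoint_mmult aE aF)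
    \<comment> \<open>\<open>E - F\<close> projects onto the complement of \<open>W\<close> in
      \<open>U\<close>. Its trace \<open>cdim U - cdim W\<close> is a sum of squares, hence
      nonnegative, and minimality of \<open>cdim U\<close> makes it 0.\<close>
    let ?D = "E - F"
    have aD: "adjoint ?D = ?D" using aE aF by (simp add: adjoint_def fun_eq_iff)
    have "?D \<odot> ?D = E - F - (F - F)"
      by (simp only: mmult_linear EF FE projects_onto_idem[OF E] projects_onto_idem[OF F])
    then have DD: "?D \<odot> ?D = ?D" by simp
    have tD: "tr \<Omega> ?D = complex_of_real (real (cdim U) - real (cdim W))"
      using E F by (simp add: tr_linear projects_onto_def)
    moreover have trD: "tr \<Omega> (adjoint ?D \<odot> ?D) = tr \<Omega> ?D" by (simp only: aD DD)
    ultimately have "real (cdim U) - real (cdim W) = (\<Sum>x\<in>\<Omega>. \<Sum>z\<in>\<Omega>. (cmod (?D z x))\<^sup>2)"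
      using tr_adjoint_mmult[of \<Omega> ?D] by (metis of_real_eq_iff)
    moreover have "\<dots> \<ge> 0" by (intro sum_nonneg) simp
    ultimately have "cdim U = cdim W" using min[OF W(1,3) subset_trans[OF W(2) U(3)]] by linarith
    then have "tr \<Omega> (adjoint ?D \<odot> ?D) = 0" using tD trD by simp
    moreover have "supported \<Omega> ?D" using E F by (auto simp: projects_onto_def supported_def)
    ultimately have "?D = 0" using adjoint_mmult_eq_0[OF finite_points] by blast
    then have "E = F" by simp
    have "u \<in> W" if "u \<in> U" for u
    proof -
      have "u = matvec \<Omega> F u" using E that \<open>E = F\<close> by (simp add: projects_onto_def)
      also have "\<dots> \<in> W" using projects_onto_matvec[OF F] W(1) by (simp add: submodule_def)
      finally show ?thesis .
    qed
    then show ?thesis using W(2) by blast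
  qed
  then show ?thesis using U unfolding irreducible_submodule_def by blast
qed

text \<open>The equations \<open>E \<odot> M = M\<close> and \<open>M \<odot> E = M\<close> encode
  an operator on \<open>U\<close>. It has an eigenvector in \<open>U\<close> by
  \<open>cyclic_eigenvector\<close>, and the eigenspace is a submodule because \<open>M\<close>
  commutes with the algebra, so it is all of \<open>U\<close>.\<close>

lemma schur:
  assumes U: "irreducible_submodule \<Omega> S U" and E: "projects_onto \<Omega> E U"
    and M: "\<And>X. X \<in> alg \<Longrightarrow> X \<odot> M = M \<odot> X" "E \<odot> M = M" "M \<odot> E = M"
  shows "\<exists>a. M = mscale a E"
proof -
  have sub: "submodule \<Omega> S U" "U \<noteq> {0}" and cs: "csubspace U" and UV: "U \<subseteq> cvectors \<Omega>"
    using U by (auto simp: irreducible_submodule_def submodule_def)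
  have supp: "supported \<Omega> M" unfolding supported_def
  proof (intro allI impI)
    fix x y assume "x \<notin> \<Omega> \<or> y \<notin> \<Omega>"
    then have "(E \<odot> M) x y = 0 \<or> (M \<odot> E) x y = 0"
      using E by (auto simp: mmult_def projects_onto_def supported_def)
    then show "M x y = 0" using M by simp
  qed
  obtain v where v: "v \<in> U" "v \<noteq> 0" using sub(2) cv.subspace_0[OF cs] by blast
  let ?T = "matvec \<Omega> M"
  have TU: "?T u \<in> U" for u
    using projects_onto_matvec[OF E cs, of "?T u"] M(2) by (simp add: matvec_mmult[symmetric])
  have powU: "(?T ^^ n) v \<in> U" for n by (cases n) (simp_all add: v TU)
  obtain B where B: "finite B" "cvectors \<Omega> \<subseteq> cv.span B"
    using cvectors_span[OF finite_points] by blast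
  have "\<exists>n c a. (\<Sum>i\<le>n. cscale (c i) ((?T ^^ i) v)) \<noteq> 0 \<and>
     ?T (\<Sum>i\<le>n. cscale (c i) ((?T ^^ i) v)) = cscale a (\<Sum>i\<le>(n::nat). cscale (c i) ((?T ^^ i) v))"
  proof (rule cyclic_eigenvector[OF cv.vector_space_axioms])
    show "(?T ^^ n) v \<in> cv.span B" for n using powU UV B(2) by blast
  qed (simp_all only: matvec_linear v B not_False_eq_True)
  then obtain n c a where *: "(\<Sum>i\<le>n. cscale (c i) ((?T ^^ i) v)) \<noteq> 0"
    "?T (\<Sum>i\<le>n. cscale (c i) ((?T ^^ i) v)) = cscale a (\<Sum>i\<le>(n::nat). cscale (c i) ((?T ^^ i) v))"
    by blast
  define y where "y = (\<Sum>i\<le>n. cscale (c i) ((?T ^^ i) v))"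
  have y: "y \<noteq> 0" "?T y = cscale a y" using * by (simp_all add: y_def)
  have yU: "y \<in> U" unfolding y_def by (intro cv.subspace_sum[OF cs] cv.subspace_scale[OF cs] powU)
  let ?W = "{u \<in> U. ?T u = cscale a u}"
  have "submodule \<Omega> S ?W" unfolding submodule_def
  proof (intro conjI ballI)
    show "csubspace ?W"
    proof (rule cv.subspaceI)
      have "?T 0 = 0" by (auto simp: matvec_def)
      then show "0 \<in> ?W" using cv.subspace_0[OF cs] by simp
    next
      fix u w assume "u \<in> ?W" "w \<in> ?W"
      then show "u + w \<in> ?W"
        using cv.subspace_add[OF cs] by (simp only: mem_Collect_eq matvec_linear cv.scale_right_distrib)
    next
      fix b u assume "u \<in> ?W"
      then show "cscale b u \<in> ?W"
        using cv.subspace_scale[OF cs]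
        by (simp only: mem_Collect_eq matvec_linear cv.scale_scale mult.commute)
    qed
    show "?W \<subseteq> cvectors \<Omega>" using UV by blast
    fix X u assume X: "X \<in> alg" and u: "u \<in> ?W"
    have "?T (matvec \<Omega> X u) = matvec \<Omega> X (?T u)"
      using M(1)[OF X] by (simp only: matvec_mmult[symmetric])
    also have "\<dots> = cscale a (matvec \<Omega> X u)" using u by (simp only: mem_Collect_eq matvec_linear)
    finally show "matvec \<Omega> X u \<in> ?W" using sub(1) X u by (auto simp: submodule_def)
  qed
  moreover have "y \<in> ?W" using y yU by simp
  ultimately have "?W = U" using U y(1) unfolding irreducible_submodule_def by blast
  then have TU: "?T u = cscale a u" if "u \<in> U" for u using that by blast
  have "M \<odot> E = mscale a E"
  proof (intro ext)
    fix x z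
    have "(\<lambda>x. (M \<odot> E) x z) = cscale a (\<lambda>x. E x z)"
      unfolding mmult_column[OF supp] using E by (intro TU) (simp add: projects_onto_def)
    from fun_cong[OF this, of x] show "(M \<odot> E) x z = mscale a E x z"
      by (simp add: cscale_def mscale_def)
  qed
  then show ?thesis using M(3) by auto
qed

lemma average_mult:
  assumes "\<And>X. X \<in> alg \<Longrightarrow> X \<odot> E = E \<odot> X"
  shows "E \<odot> average B = average (E \<odot> B)" "average B \<odot> E = average (B \<odot> E)"
proof -
  have "E \<odot> (adj s \<odot> B \<odot> adj (s\<inverse>)) = adj s \<odot> (E \<odot> B) \<odot> adj (s\<inverse>)" if "s \<in> S" for s
    using assms[OF alg_adj[OF that]] by (metis mmult_assoc)
  then show "E \<odot> average B = average (E \<odot> B)"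
    unfolding average_def mmult_sum mmult_linear by (intro sum.cong) simp_all
  have "(adj s \<odot> B \<odot> adj (s\<inverse>)) \<odot> E = adj s \<odot> (B \<odot> E) \<odot> adj (s\<inverse>)" if "s \<in> S" for s
    using assms[OF alg_adj[OF converse_in[OF that]]] by (metis mmult_assoc)
  then show "average B \<odot> E = average (B \<odot> E)"
    unfolding average_def mmult_sum mmult_linear by (intro sum.cong) simp_all
qed

text \<open>Schur's lemma leaves one scalar, which is found by taking traces: that of
  \<open>E\<close> is \<open>cdim U\<close>, that of \<open>average B\<close> is the trace of
  \<open>B \<odot> casimir\<close>.\<close>

lemma average_schur:
  assumes U: "irreducible_submodule \<Omega> S U" and E: "projects_onto \<Omega> E U"
    and C: "casimir \<odot> E = mscale \<nu> E" and B: "E \<odot> B = B" "B \<odot> E = B"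
  shows "average B = mscale (\<nu> * tr \<Omega> B / of_nat (cdim U)) E"
proof -
  have sub: "submodule \<Omega> S U" "U \<noteq> {0}" using U by (auto simp: irreducible_submodule_def)
  note comm = projection_commute[OF sub(1) E]
  obtain a where a: "average B = mscale a E"
    using schur[OF U E average_commute] average_mult[OF comm, of B] B by auto
  have "a * of_nat (cdim U) = tr \<Omega> (average B)"
    using E by (simp add: a tr_linear projects_onto_def)
  also have "\<dots> = tr \<Omega> (B \<odot> (E \<odot> casimir))"
    using B(2) by (simp only: tr_average mmult_assoc[symmetric])
  also have "E \<odot> casimir = mscale \<nu> E"
    using comm[OF central_alg[OF central_casimir]] C by simp
  finally have "a * of_nat (cdim U) = \<nu> * tr \<Omega> B" by (simp add: mmult_linear tr_linear B)
  then show ?thesis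
    using submodule_dim_nonzero[OF sub E] by (simp add: a field_simps)
qed

text \<open>Orthogonality relation for the character of \<open>U\<close>, whose value at
  \<open>adj s\<close> is \<open>tr \<Omega> (adj s \<odot> E)\<close>. It is assembled from
  relations between matrix entries, one for each pair \<open>y\<close>, \<open>z\<close>.\<close>

lemma character_norm:
  assumes U: "irreducible_submodule \<Omega> S U" and E: "projects_onto \<Omega> E U"
    and C: "casimir \<odot> E = mscale \<nu> E"
  shows "(\<Sum>s\<in>S. 1 / of_nat (card s) * tr \<Omega> (adj s \<odot> E) * tr \<Omega> (E \<odot> adj (s\<inverse>))) = \<nu>"
proof -
  let ?n = "of_nat (cdim U) :: complex"
  have n0: "?n \<noteq> 0"
    using submodule_dim_nonzero[OF _ _ E] U by (auto simp: irreducible_submodule_def)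
  have idem: "E \<odot> E = E" by (rule projects_onto_idem[OF E])
  have *: "(\<Sum>s\<in>S. 1 / of_nat (card s) * ((adj s \<odot> E) y y * (E \<odot> adj (s\<inverse>)) z z))
      = \<nu> / ?n * (E y z * E z y)" for y z
  proof -
    \<comment> \<open>Column \<open>y\<close> of \<open>E\<close> times row \<open>z\<close> of
      \<open>E\<close>. Around this matrix a product \<open>A \<odot> B \<odot> A'\<close>
      separates, and its entry at \<open>(y, z)\<close> is a product of two diagonal entries;
      summation over \<open>y\<close> and \<open>z\<close> yields the two traces.\<close>
    define B where "B x w = E x y * E z w" for x w
    have sandwich: "(A \<odot> B \<odot> A') x w = (A \<odot> E) x y * (E \<odot> A') z w" for A A' x w
      by (simp add: mmult_def B_def sum_distrib_left sum_distrib_right mult.assoc)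
    have "(E \<odot> B) x w = B x w" for x w
    proof -
      have "(E \<odot> B) x w = (E \<odot> E) x y * E z w"
        by (simp add: mmult_def B_def sum_distrib_right mult.assoc)
      then show ?thesis by (simp add: idem B_def)
    qed
    then have EB: "E \<odot> B = B" by blast
    have "(B \<odot> E) x w = B x w" for x w
    proof -
      have "(B \<odot> E) x w = E x y * (E \<odot> E) z w"
        by (simp add: mmult_def B_def sum_distrib_left mult.assoc)
      then show ?thesis by (simp add: idem B_def)
    qed
    then have BE: "B \<odot> E = B" by blast
    have "tr \<Omega> B = (E \<odot> E) z y" by (simp add: tr_def B_def mmult_def mult.commute)
    then have trB: "tr \<Omega> B = E z y" by (simp add: idem)
    have "average B y z = \<nu> / ?n * (E y z * E z y)"
      unfolding average_schur[OF U E C EB BE] trB by (simp add: mscale_def)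
    then show ?thesis unfolding average_def sum_fun_apply2 mscale_def sandwich .
  qed
  have "(\<Sum>s\<in>S. 1 / of_nat (card s) * tr \<Omega> (adj s \<odot> E) * tr \<Omega> (E \<odot> adj (s\<inverse>)))
     = (\<Sum>s\<in>S. \<Sum>y\<in>\<Omega>. \<Sum>z\<in>\<Omega>. 1 / of_nat (card s) * ((adj s \<odot> E) y y * (E \<odot> adj (s\<inverse>)) z z))"
    unfolding tr_def mult.assoc sum_product by (simp only: sum_distrib_left)
  also have "\<dots> = (\<Sum>y\<in>\<Omega>. \<Sum>s\<in>S. \<Sum>z\<in>\<Omega>. 1 / of_nat (card s) * ((adj s \<odot> E) y y * (E \<odot> adj (s\<inverse>)) z z))"
    by (rule sum.swap)
  also have "\<dots> = (\<Sum>y\<in>\<Omega>. \<Sum>z\<in>\<Omega>. \<Sum>s\<in>S. 1 / of_nat (card s) * ((adj s \<odot> E) y y * (E \<odot> adj (s\<inverse>)) z z))"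
    by (rule sum.cong[OF refl], rule sum.swap)
  also have "\<dots> = \<nu> / ?n * tr \<Omega> (E \<odot> E)"
    unfolding * by (simp add: tr_def mmult_def sum_distrib_left)
  also have "\<dots> = \<nu>" using E n0 by (simp add: idem projects_onto_def)
  finally show ?thesis .
qed

text \<open>The projection \<open>Z\<close> of \<open>E\<close> to the algebra represents the character of \<open>U\<close> with respect to the
  trace form. It is central, hence \<open>Z = \<mu> P\<close>, so \<open>\<mu> rk P = tr E = n\<close>, while orthogonality gives
  \<open>\<nu> = tr (Z E) = \<mu> n\<close>.\<close>

lemma primitive_casimir:
  assumes P: "P \<in> primitives" and U: "irreducible_submodule \<Omega> S U" "\<And>u. u \<in> U \<Longrightarrow> matvec \<Omega> P u = u"
    and C: "casimir \<odot> P = mscale \<nu> P"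
  shows "\<nu> * of_nat (mat_rank \<Omega> P) = (of_nat (cdim U))\<^sup>2"
proof -
  have cP: "central P" "P \<noteq> 0" "P \<odot> P = P"
    using P by (auto simp: central_primitive_idempotents_def central_idempotent_iff)
  have sub: "submodule \<Omega> S U" using U by (auto simp: irreducible_submodule_def)
  then obtain E where E: "projects_onto \<Omega> E U" using projection_exists by blast
  note comm = projection_commute[OF sub E]
  have PE: "P \<odot> E = E"
  proof (intro ext)
    fix x y
    have "(\<lambda>x. (P \<odot> E) x y) = (\<lambda>x. E x y)"
      using E U(2) alg_supported[OF central_alg[OF cP(1)]] by (simp add: mmult_column projects_onto_def)
    then show "(P \<odot> E) x y = E x y" by (rule fun_cong)
  qed
  then have EP: "E \<odot> P = E" using comm[OF central_alg[OF cP(1)]] by simp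
  have "casimir \<odot> E = (casimir \<odot> P) \<odot> E" by (simp only: mmult_assoc PE)
  then have CE: "casimir \<odot> E = mscale \<nu> E" by (simp only: C mmult_linear PE)
  define Z where "Z = (\<Sum>s\<in>S. mscale (tr \<Omega> (E \<odot> adj (s\<inverse>)) / of_nat (card s)) (adj s))"
  have Zalg: "Z \<in> alg" unfolding Z_def by (intro alg_sum alg_scale alg_adj)
  have trZ: "tr \<Omega> (Z \<odot> X) = tr \<Omega> (E \<odot> X)" if X: "X \<in> alg" for X
  proof -
    have "tr \<Omega> (E \<odot> X) = tr \<Omega> (E \<odot> (\<Sum>s\<in>S. mscale (tr \<Omega> (X \<odot> adj s) / of_nat (card s)) (adj (s\<inverse>))))"
      using alg_expansion_converse[OF X] by simp
    also have "\<dots> = (\<Sum>s\<in>S. tr \<Omega> (adj s \<odot> X) / of_nat (card s) * tr \<Omega> (E \<odot> adj (s\<inverse>)))"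
      by (simp only: mmult_sum mmult_linear tr_sum tr_linear tr_mmult_commute[of \<Omega> X])
    also have "\<dots> = tr \<Omega> (Z \<odot> X)"
      unfolding Z_def by (simp add: mmult_sum mmult_linear tr_sum tr_linear mult.commute)
    finally show ?thesis by simp
  qed
  have cZ: "central Z" unfolding central_def
  proof (intro conjI ballI Zalg)
    fix Y assume Y: "Y \<in> alg"
    have "Z \<odot> Y - Y \<odot> Z = 0"
    proof (rule alg_eq_0)
      show "Z \<odot> Y - Y \<odot> Z \<in> alg" by (intro alg_diff alg_mult Y Zalg)
      fix X assume X: "X \<in> alg"
      have "tr \<Omega> (Z \<odot> Y \<odot> X) = tr \<Omega> (E \<odot> (Y \<odot> X))" by (simp only: mmult_assoc trZ alg_mult X Y)
      also have "\<dots> = tr \<Omega> (E \<odot> (X \<odot> Y))"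
        using comm[OF Y] by (metis mmult_assoc tr_mmult_commute)
      also have "\<dots> = tr \<Omega> (Z \<odot> (X \<odot> Y))" by (simp only: trZ alg_mult X Y)
      also have "\<dots> = tr \<Omega> (Y \<odot> Z \<odot> X)" by (metis mmult_assoc tr_mmult_commute)
      finally show "tr \<Omega> ((Z \<odot> Y - Y \<odot> Z) \<odot> X) = 0" by (simp only: mmult_linear tr_linear) simp
    qed
    then show "Z \<odot> Y = Y \<odot> Z" by simp
  qed
  have "Z \<odot> P - Z = 0"
  proof (rule alg_eq_0)
    have Palg: "P \<in> alg" by (rule central_alg[OF cP(1)])
    show "Z \<odot> P - Z \<in> alg" by (intro alg_diff alg_mult Palg Zalg)
    fix X assume X: "X \<in> alg"
    have "tr \<Omega> (Z \<odot> P \<odot> X) = tr \<Omega> (E \<odot> P \<odot> X)"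
      by (simp only: mmult_assoc trZ alg_mult X Palg)
    also have "\<dots> = tr \<Omega> (Z \<odot> X)" by (simp only: EP trZ X)
    finally show "tr \<Omega> ((Z \<odot> P - Z) \<odot> X) = 0" by (simp only: mmult_linear tr_linear) simp
  qed
  then have ZP: "Z \<odot> P = Z" by simp
  obtain \<mu> where "Z \<odot> P = mscale \<mu> P" using central_mult_primitive[OF P cZ] by blast
  then have Z: "Z = mscale \<mu> P" using ZP by simp
  have One: "supported \<Omega> Z" "supported \<Omega> E"
    using alg_supported[OF Zalg] E by (auto simp: projects_onto_def)
  have trE: "tr \<Omega> E = of_nat (cdim U)" using E by (simp add: projects_onto_def)
  have "\<mu> * of_nat (mat_rank \<Omega> P) = tr \<Omega> Z"
    using tr_idempotent[OF finite_points alg_supported[OF central_alg[OF cP(1)]] cP(3)]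
    by (simp add: Z tr_linear)
  also have "\<dots> = tr \<Omega> E"
    using trZ[OF alg_adj[OF Id_in]] by (simp add: One_mult One)
  finally have 1: "\<mu> * of_nat (mat_rank \<Omega> P) = of_nat (cdim U)" by (simp add: trE)
  have "\<nu> = (\<Sum>s\<in>S. tr \<Omega> (E \<odot> adj (s\<inverse>)) / of_nat (card s) * tr \<Omega> (adj s \<odot> E))"
    unfolding character_norm[OF U(1) E CE, symmetric] by (rule sum.cong) simp_all
  also have "\<dots> = tr \<Omega> (Z \<odot> E)"
    unfolding Z_def by (simp only: mmult_sum mmult_linear tr_sum tr_linear)
  also have "\<dots> = \<mu> * of_nat (cdim U)"
    unfolding Z by (simp only: mmult_linear tr_linear PE trE)
  finally have "\<nu> * of_nat (mat_rank \<Omega> P) = of_nat (cdim U) * (\<mu> * of_nat (mat_rank \<Omega> P))" by simp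
  then show ?thesis unfolding 1 by (simp add: power2_eq_square)
qed

end

section \<open>The Casimir element of a pseudocyclic scheme\<close>

context association_scheme
begin

text \<open>The row size is the intersection number of \<open>s\<close> and its converse at the
  diagonal, so it is the same at the arbitrary point in the definition of \<open>valency\<close> and
  at \<open>x\<close>.\<close>

lemma row_card:
  assumes "s \<in> S" "x \<in> \<Omega>"
  shows "card {b. (x, b) \<in> s} = valency s"
proof -
  have eq: "card {b. (y, b) \<in> s} = cnt s (s\<inverse>) y y" for y by (simp add: cnt_def)
  obtain p where p: "p \<in> s" using rel_nonempty[OF assms(1)] by blast
  then have "(SOME p. p \<in> s) \<in> s" by (rule someI)
  then have "fst (SOME p. p \<in> s) \<in> \<Omega>" using rel_subset[OF assms(1)] by (auto simp: mem_Times_iff)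
  then show ?thesis
    unfolding valency_def eq using cnt_eq[OF assms(1) converse_in[OF assms(1)] Id_in] assms(2) by blast
qed

lemma card_rel:
  assumes "s \<in> S"
  shows "card s = card \<Omega> * valency s"
proof -
  have "s = (SIGMA x:\<Omega>. {b. (x, b) \<in> s})" using rel_subset[OF assms] by auto
  moreover have "card (SIGMA x:\<Omega>. {b. (x, b) \<in> s}) = (\<Sum>x\<in>\<Omega>. card {b. (x, b) \<in> s})"
  proof (rule card_SigmaI[OF finite_points], rule ballI)
    fix x
    have "{b. (x, b) \<in> s} \<subseteq> \<Omega>" using rel_subset[OF assms] by auto
    then show "finite {b. (x, b) \<in> s}" using finite_points finite_subset by blast
  qed
  ultimately show ?thesis using row_card[OF assms] by simp
qed

lemma card_points_pos: "card \<Omega> > 0"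
  using finite_points points_nonempty by (simp add: card_gt_0_iff)

lemma valency_pos: "s \<in> S \<Longrightarrow> valency s > 0"
  using card_rel_pos[of s] card_rel[of s] by (metis mult_0_right not_gr_zero)

lemma valency_converse: "s \<in> S \<Longrightarrow> valency (s\<inverse>) = valency s"
  using card_rel[of s] card_rel[OF converse_in, of s] card_points_pos by simp

lemma valency_Id: "valency (Id_on \<Omega>) = 1"
proof -
  have "Id_on \<Omega> = (\<lambda>x. (x, x)) ` \<Omega>" by auto
  then have "card (Id_on \<Omega>) = card \<Omega>" by (simp add: card_image inj_on_def)
  then show ?thesis using card_rel[OF Id_in] card_points_pos by simp
qed

lemma sum_valency: "(\<Sum>s\<in>S. valency s) = card \<Omega>"
proof -
  have "card (\<Omega> \<times> \<Omega>) = (\<Sum>s\<in>S. card s)"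
    unfolding rel_cover[symmetric]
  proof (rule card_Union_disjoint)
    show "pairwise disjnt S" using rel_eqI unfolding pairwise_def disjnt_def by blast
    show "\<And>A. A \<in> S \<Longrightarrow> finite A" by (rule finite_rel)
  qed
  also have "\<dots> = card \<Omega> * (\<Sum>s\<in>S. valency s)" by (simp add: card_rel sum_distrib_left)
  finally show ?thesis using card_points_pos by (simp add: card_cartesian_product)
qed

lemma card_points_eq:
  assumes "\<forall>s\<in>S - {Id_on \<Omega>}. valency s = k"
  shows "card \<Omega> = 1 + k * (card S - 1)"
proof -
  have "card \<Omega> = valency (Id_on \<Omega>) + (\<Sum>s\<in>S - {Id_on \<Omega>}. valency s)"
    unfolding sum_valency[symmetric] by (rule sum.remove[OF finite_rels Id_in])
  then show ?thesis using assms Id_in finite_rels by (simp add: valency_Id)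
qed

section \<open>The trivial idempotent and the remaining primitives\<close>

abbreviation J :: "'a \<Rightarrow> 'a \<Rightarrow> complex" where "J \<equiv> Jnorm \<Omega>"

lemma adj_row_sum:
  assumes "s \<in> S" "x \<in> \<Omega>"
  shows "(\<Sum>z\<in>\<Omega>. adj s x z) = of_nat (valency s)"
proof -
  have "(\<Sum>z\<in>\<Omega>. adj s x z) = of_nat (card {z \<in> \<Omega>. (x, z) \<in> s})"
    using finite_points by (simp add: adj_def sum.If_cases Int_def)
  also have "{z \<in> \<Omega>. (x, z) \<in> s} = {b. (x, b) \<in> s}" using rel_subset[OF assms(1)] by auto
  finally show ?thesis using row_card[OF assms] by simp
qed

lemma adj_mult_J:
  assumes "s \<in> S"
  shows "adj s \<odot> J = mscale (of_nat (valency s)) J" "J \<odot> adj s = mscale (of_nat (valency s)) J"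
proof -
  have out: "adj s x z = 0" if "x \<notin> \<Omega> \<or> z \<notin> \<Omega>" for x z
    using that rel_subset[OF assms] by (auto simp: adj_def)
  show "adj s \<odot> J = mscale (of_nat (valency s)) J"
  proof (intro ext)
    fix x y
    have "(adj s \<odot> J) x y = (if y \<in> \<Omega> then (\<Sum>z\<in>\<Omega>. adj s x z) / of_nat (card \<Omega>) else 0)"
      by (simp add: mmult_def Jnorm_def sum_divide_distrib)
    then show "(adj s \<odot> J) x y = mscale (of_nat (valency s)) J x y"
      using adj_row_sum[OF assms] out by (cases "x \<in> \<Omega>") (auto simp: mscale_def Jnorm_def)
  qed
  show "J \<odot> adj s = mscale (of_nat (valency s)) J"
  proof (intro ext)
    fix x y
    have "(J \<odot> adj s) x y = (if x \<in> \<Omega> then (\<Sum>z\<in>\<Omega>. adj (s\<inverse>) y z) / of_nat (card \<Omega>) else 0)"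
      by (simp add: mmult_def Jnorm_def sum_divide_distrib adj_converse)
    then show "(J \<odot> adj s) x y = mscale (of_nat (valency s)) J x y"
      using adj_row_sum[OF converse_in[OF assms]] out valency_converse[OF assms]
      by (cases "y \<in> \<Omega>") (auto simp: mscale_def Jnorm_def adj_converse)
  qed
qed

text \<open>The scalars on both sides agree because a relation and its converse have equal valency;
  hence \<open>J\<close> is central.\<close>

lemma alg_mult_J:
  assumes "X \<in> alg"
  shows "\<exists>\<rho>. X \<odot> J = mscale \<rho> J \<and> J \<odot> X = mscale \<rho> J"
proof -
  obtain c where c: "X = (\<Sum>s\<in>S. mscale (c s) (adj s))" using alg_comb[OF assms] by blast
  have "X \<odot> J = mscale (\<Sum>s\<in>S. c s * of_nat (valency s)) J"
    unfolding c by (simp add: mmult_sum mmult_linear adj_mult_J mv.scale_sum_left)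
  moreover have "J \<odot> X = mscale (\<Sum>s\<in>S. c s * of_nat (valency s)) J"
    unfolding c by (simp add: mmult_sum mmult_linear adj_mult_J mv.scale_sum_left)
  ultimately show ?thesis by blast
qed

lemma J_idem: "J \<odot> J = J"
  using card_points_pos by (auto simp: mmult_def Jnorm_def fun_eq_iff)

lemma J_nonzero: "J \<noteq> 0"
proof
  assume J: "J = 0"
  obtain x where "x \<in> \<Omega>" using points_nonempty by blast
  then have "J x x \<noteq> 0" using card_points_pos by (simp add: Jnorm_def)
  then show False using J by simp
qed

lemma central_J: "central J"
proof -
  have "J \<in> alg"
  proof (rule algI)
    show "supported \<Omega> J" by (auto simp: supported_def Jnorm_def)
    fix t x y x' y' assume t: "t \<in> S" "(x, y) \<in> t" "(x', y') \<in> t"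
    show "J x y = J x' y'" using rel_subset[OF t(1)] t(2,3) by (auto simp: Jnorm_def)
  qed
  then show ?thesis unfolding central_def using alg_mult_J by metis
qed

text \<open>The term of \<open>s\<close> acts on \<open>J\<close> as
  \<open>(valency s)\<^sup>2 / card s\<close>, which is \<open>valency s / card \<Omega>\<close>,
  and the valencies add up to \<open>card \<Omega>\<close>.\<close>

lemma casimir_mult_J: "casimir \<odot> J = J"
proof -
  have "casimir \<odot> J = (\<Sum>s\<in>S. mscale (of_nat (valency s) / of_nat (card \<Omega>)) J)"
    unfolding casimir_def mmult_sum mmult_linear
  proof (rule sum.cong[OF refl])
    fix s assume s: "s \<in> S"
    have "adj s \<odot> adj (s\<inverse>) \<odot> J = mscale (of_nat (valency s) * of_nat (valency s)) J"
      using s by (simp add: mmult_assoc mmult_linear adj_mult_J converse_in valency_converse)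
    then show "mscale (1 / of_nat (card s)) (adj s \<odot> adj (s\<inverse>) \<odot> J) =
        mscale (of_nat (valency s) / of_nat (card \<Omega>)) J"
      using valency_pos[OF s] by (simp add: card_rel[OF s])
  qed
  also have "\<dots> = mscale (of_nat (\<Sum>s\<in>S. valency s) / of_nat (card \<Omega>)) J"
    by (simp add: mv.scale_sum_left[symmetric] sum_divide_distrib)
  also have "\<dots> = J" using card_points_pos by (simp add: sum_valency)
  finally show ?thesis .
qed

text \<open>\<open>J \<odot> P\<close> is an idempotent multiple of \<open>J\<close>. Were it
  \<open>J\<close> itself, \<open>primitive_absorb\<close> would give \<open>J = P\<close>.\<close>

lemma primitive_mult_J:
  assumes P: "P \<in> primitives" "P \<noteq> J"
  shows "J \<odot> P = 0"
proof -
  have cP: "central P" "P \<odot> P = P"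
    using P by (auto simp: central_primitive_idempotents_def central_idempotent_iff)
  obtain \<rho> where \<rho>: "J \<odot> P = mscale \<rho> J" using alg_mult_J[OF central_alg[OF cP(1)]] by blast
  have "mscale \<rho> J = J \<odot> P \<odot> P" using \<rho> cP(2) mmult_assoc by metis
  also have "\<dots> = mscale (\<rho> * \<rho>) J" by (simp add: \<rho> mmult_linear)
  finally have "\<rho> = 0 \<or> \<rho> = 1" using J_nonzero by simp
  moreover have "\<rho> \<noteq> 1"
    using primitive_absorb[OF P(1) central_J J_nonzero J_idem] \<rho> P(2) by auto
  ultimately show ?thesis using \<rho> by simp
qed

text \<open>Takes the place of a decomposition of \<open>One\<close> into primitives. A central
  idempotent \<open>e\<close> of least rank with \<open>D \<odot> e \<noteq> 0\<close> is primitive: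
  in a splitting of \<open>e\<close> one summand would again not be annihilated by \<open>D\<close>,
  yet have smaller rank, as the rank of an idempotent is its trace and so is additive.\<close>

lemma primitive_exists:
  assumes D: "D \<in> alg" "D \<noteq> 0"
  shows "\<exists>P\<in>primitives. D \<odot> P \<noteq> 0"
proof -
  let ?Q = "\<lambda>e. central_idempotent \<Omega> S e \<and> D \<odot> e \<noteq> 0"
  have D1: "D \<odot> One = D" by (rule One_mult(2)[OF alg_supported[OF D(1)]])
  then have "One \<noteq> 0" using D(2) mmult_linear(8) by metis
  then have "?Q One"
    using central_One D D1 One_mult alg_supported alg_adj Id_in by (simp add: central_idempotent_iff)
  then obtain e where e: "?Q e" and min: "\<And>f. ?Q f \<Longrightarrow> mat_rank \<Omega> e \<le> mat_rank \<Omega> f"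
    using ex_has_least_nat[of ?Q One "mat_rank \<Omega>"] by blast
  have rank: "tr \<Omega> f = of_nat (mat_rank \<Omega> f)" if "central_idempotent \<Omega> S f" for f
    using that tr_idempotent[OF finite_points alg_supported[OF central_alg]]
    by (simp add: central_idempotent_iff)
  have rank_pos: "mat_rank \<Omega> f > 0" if "central_idempotent \<Omega> S f" for f
    using that mat_rank_idempotent_pos[OF finite_points alg_supported[OF central_alg]]
    by (simp add: central_idempotent_iff)
  have "e \<in> primitives"
    unfolding central_primitive_idempotents_def
  proof (intro CollectI conjI notI)
    show "central_idempotent \<Omega> S e" using e by blast
    assume "\<exists>Q R. central_idempotent \<Omega> S Q \<and> central_idempotent \<Omega> S R \<and> Q \<odot> R = 0 \<and> e = Q + R"
    then obtain Q R where QR: "central_idempotent \<Omega> S Q" "central_idempotent \<Omega> S R" "e = Q + R"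
      by blast
    have "of_nat (mat_rank \<Omega> e) = (of_nat (mat_rank \<Omega> Q + mat_rank \<Omega> R) :: complex)"
      using rank[OF QR(1)] rank[OF QR(2)] rank[of e] e by (simp only: QR(3) tr_linear of_nat_add)
    then have sum: "mat_rank \<Omega> e = mat_rank \<Omega> Q + mat_rank \<Omega> R" by (simp only: of_nat_eq_iff)
    have "D \<odot> Q \<noteq> 0 \<or> D \<odot> R \<noteq> 0"
      using e unfolding QR(3) mmult_linear by (metis add.right_neutral)
    then show False
      using min[of Q] min[of R] QR(1,2) sum rank_pos by fastforce
  qed
  then show ?thesis using e by blast
qed

text \<open>Justifies the choice in the definition of \<open>n_P\<close>.\<close>

lemma primitive_irreducible_exists:
  assumes "central_idempotent \<Omega> S P"
  shows "\<exists>U. irreducible_submodule \<Omega> S U \<and> (\<forall>u\<in>U. matvec \<Omega> P u = u)"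
proof -
  let ?U = "range (matvec \<Omega> P)"
  have cP: "central P" "P \<noteq> 0" "P \<odot> P = P" using assms by (simp_all add: central_idempotent_iff)
  have supp: "supported \<Omega> P" by (rule alg_supported[OF central_alg[OF cP(1)]])
  have "submodule \<Omega> S ?U"
    unfolding submodule_def
  proof (intro conjI ballI csubspace_range range_subset_cvectors)
    fix M u assume M: "M \<in> alg" and "u \<in> ?U"
    then obtain v where "u = matvec \<Omega> P v" by blast
    then have "matvec \<Omega> M u = matvec \<Omega> P (matvec \<Omega> M v)"
      using central_commute[OF cP(1) M] by (simp only: matvec_mmult[symmetric])
    then show "matvec \<Omega> M u \<in> ?U" by (metis rangeI)
  qed
  moreover have "?U \<noteq> {0}"
  proof
    assume U0: "?U = {0}"
    have "(P \<odot> P) x y = 0" for x y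
    proof -
      have "(\<lambda>x. (P \<odot> P) x y) = 0" using mmult_column[OF supp, of P y] U0 by (metis rangeI singletonD)
      from fun_cong[OF this, of x] show ?thesis by simp
    qed
    then have "P = 0" using cP(3) by (simp add: fun_eq_iff)
    then show False using cP(2) by blast
  qed
  ultimately obtain U where U: "irreducible_submodule \<Omega> S U" "U \<subseteq> ?U"
    using irreducible_exists by blast
  have "matvec \<Omega> P u = u" if "u \<in> ?U" for u
    using that cP(3) by (metis (no_types, lifting) imageE matvec_mmult)
  then show ?thesis using U by blast
qed

text \<open>By \<open>primitive_exists\<close> the identity may be tested on each primitive. Both
  sides fix \<open>J\<close>; any other primitive is annihilated by \<open>J\<close>, and there
  pseudocyclicity makes the Casimir scalar constant.\<close>

lemma casimir_pseudocyclic: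
  assumes pc: "pseudocyclic \<Omega> S"
  shows "\<exists>c. casimir = mscale c (One - J) + J"
proof -
  obtain c :: real where c: "\<And>P. P \<in> primitives - {J} \<Longrightarrow> m_P \<Omega> S P / real (n_P \<Omega> S P) = c"
    using pc unfolding pseudocyclic_def by blast
  \<comment> \<open>The scalar is \<open>1 / c\<close> because \<open>m_P / n_P\<close> is the rank
    divided by the squared dimension, while \<open>primitive_casimir\<close> gives the inverse
    ratio.\<close>
  define D where "D = casimir - (mscale (of_real (1 / c)) (One - J) + J)"
  have cD: "central D" unfolding D_def
    by (intro central_diff central_add central_scale central_casimir central_One central_J)
  have "D = 0"
  proof (rule ccontr)
    assume "D \<noteq> 0"
    then obtain P where P: "P \<in> primitives" "D \<odot> P \<noteq> 0"
      using primitive_exists[OF central_alg[OF cD]] by blast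
    have ci: "central_idempotent \<Omega> S P" using P by (auto simp: central_primitive_idempotents_def)
    then have cP: "central P" "P \<noteq> 0" "P \<odot> P = P" by (simp_all add: central_idempotent_iff)
    have supp: "supported \<Omega> P" by (rule alg_supported[OF central_alg[OF cP(1)]])
    have DM: "D \<odot> M = casimir \<odot> M - (mscale (of_real (1 / c)) (M - J \<odot> M) + J \<odot> M)"
      if "supported \<Omega> M" for M
      unfolding D_def by (simp only: mmult_linear One_mult[OF that])
    have "D \<odot> J = 0"
      unfolding DM[OF alg_supported[OF central_alg[OF central_J]]] casimir_mult_J J_idem by simp
    then have PJ: "P \<noteq> J" using P(2) by metis
    have JP: "J \<odot> P = 0" by (rule primitive_mult_J[OF P(1) PJ])
    obtain \<nu> where \<nu>: "casimir \<odot> P = mscale \<nu> P"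
      using central_mult_primitive[OF P(1) central_casimir] by blast
    \<comment> \<open>The same choice as in \<open>n_P\<close>, so that the dimension in the
      hypothesis is the dimension of this \<open>U\<close>.\<close>
    define U where "U = (SOME U. irreducible_submodule \<Omega> S U \<and> (\<forall>u\<in>U. matvec \<Omega> P u = u))"
    have U: "irreducible_submodule \<Omega> S U" "\<And>u. u \<in> U \<Longrightarrow> matvec \<Omega> P u = u"
      using someI_ex[OF primitive_irreducible_exists[OF ci]] unfolding U_def by blast+
    have n: "n_P \<Omega> S P = cdim U" by (simp add: n_P_def U_def)
    have sub: "submodule \<Omega> S U" "U \<noteq> {0}" using U(1) by (auto simp: irreducible_submodule_def)
    obtain E where "projects_onto \<Omega> E U" using projection_exists[OF sub(1)] by blast
    then have n0: "cdim U \<noteq> 0" by (rule submodule_dim_nonzero[OF sub])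
    have r0: "mat_rank \<Omega> P > 0"
      by (rule mat_rank_idempotent_pos[OF finite_points supp cP(3,2)])
    have cval: "c = real (mat_rank \<Omega> P) / (real (cdim U))\<^sup>2"
      using c[of P] P(1) PJ by (simp add: m_P_def n power2_eq_square)
    have "\<nu> * of_nat (mat_rank \<Omega> P) = (of_nat (cdim U))\<^sup>2"
      by (rule primitive_casimir[OF P(1) U \<nu>])
    then have "\<nu> = of_real (1 / c)" using n0 r0 unfolding cval by (simp add: field_simps)
    then have "D \<odot> P = 0" unfolding DM[OF supp] JP \<nu> by simp
    then show False using P(2) by blast
  qed
  then show ?thesis unfolding D_def by (metis eq_iff_diff_eq_0)
qed

lemma casimir_apply:
  "casimir x y = (\<Sum>s\<in>S. of_nat (card {z. (x, z) \<in> s \<and> (y, z) \<in> s}) / of_nat (card s))"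
  unfolding casimir_def sum_fun_apply2 mscale_def
  by (rule sum.cong) (simp_all add: adj_mult_apply cnt_def)

text \<open>The entry of \<open>casimir\<close> at \<open>(x, y)\<close> counts these points
  \<open>z\<close> with weights \<open>1 / card s\<close>, and the weights coincide because the
  nontrivial relations have equal size. The diagonal entries determine the constant \<open>c\<close>
  of \<open>casimir_pseudocyclic\<close>.\<close>

lemma pseudocyclic_indistinguishing:
  assumes pc: "pseudocyclic \<Omega> S" and val: "\<forall>s\<in>S - {Id_on \<Omega>}. valency s = k"
    and xy: "x \<in> \<Omega>" "y \<in> \<Omega>" "x \<noteq> y"
  shows "card {z. \<exists>s\<in>S. (x, z) \<in> s \<and> (y, z) \<in> s} = k - 1"
proof -
  let ?N = "of_nat (card \<Omega>) :: complex" and ?R = "of_nat (card S) :: complex"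
  let ?k = "of_nat k :: complex"
  let ?E = "\<lambda>s. {z. (x, z) \<in> s \<and> (y, z) \<in> s}"
  have N: "?N \<noteq> 0" using card_points_pos by simp
  obtain c where c: "casimir = mscale c (One - J) + J" using casimir_pseudocyclic[OF pc] by blast
  obtain t where t: "t \<in> S" "(x, y) \<in> t" using rel_cover xy(1,2) by blast
  have "t \<noteq> Id_on \<Omega>" using t xy by auto
  then have "valency t = k" using val t(1) by blast
  then have k: "k > 0" using valency_pos[OF t(1)] by simp
  have "card \<Omega> = 1 + k * (card S - 1)" by (rule card_points_eq[OF val])
  moreover have "card S \<ge> 1" using finite_rels Id_in by (metis One_nat_def Suc_leI card_gt_0_iff empty_iff)
  ultimately have Nk: "?N = 1 + ?k * (?R - 1)" by (simp add: of_nat_diff)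
  \<comment> \<open>Each relation contributes \<open>valency s / card s = 1 / card \<Omega>\<close>
    here. Together with \<open>card \<Omega> - 1 = k * (card S - 1)\<close> this leads to
    \<open>c * k = 1\<close>.\<close>
  have "casimir x x = (\<Sum>s\<in>S. 1 / ?N)"
    unfolding casimir_apply
    by (rule sum.cong) (use valency_pos card_rel row_card[OF _ xy(1)] in auto)
  then have "?R / ?N = c * (1 - 1 / ?N) + 1 / ?N"
    using c xy by (simp add: mscale_def adj_def Jnorm_def Id_on_iff)
  then have 1: "?R - 1 = c * (?N - 1)" using N by (simp add: field_simps)
  have "card \<Omega> \<ge> 2" using card_mono[OF finite_points, of "{x, y}"] xy by simp
  then have "?N \<noteq> 1" by (metis of_nat_1 of_nat_eq_iff numeral_le_one_iff semiring_norm(69))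
  moreover have "?N - 1 = c * ?k * (?N - 1)"
    using arg_cong[OF 1, of "(*) ?k"] Nk by (simp only: add_diff_cancel_left') (simp only: ac_simps)
  ultimately have ck: "c * ?k = 1" by simp
  have fin: "finite (?E s)" if "s \<in> S" for s
    by (rule finite_subset[OF _ finite_points]) (use rel_subset[OF that] in auto)
  have "casimir x y = (\<Sum>s\<in>S. of_nat (card (?E s)) / (?N * ?k))"
    unfolding casimir_apply
  proof (rule sum.cong[OF refl])
    fix s assume s: "s \<in> S"
    show "of_nat (card (?E s)) / of_nat (card s) = of_nat (card (?E s)) / (?N * ?k)"
    \<comment> \<open>The diagonal relation has a different size, but as \<open>x \<noteq> y\<close>
      its summand is 0 with either denominator.\<close>
    proof (cases "s = Id_on \<Omega>")
      case True
      then have "?E s = {}" using xy(3) by auto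
      then show ?thesis by (simp only: card.empty of_nat_0 div_0)
    next
      case False
      then show ?thesis using val s by (simp add: card_rel)
    qed
  qed
  also have "\<dots> = of_nat (\<Sum>s\<in>S. card (?E s)) / (?N * ?k)" by (simp add: sum_divide_distrib)
  also have "(\<Sum>s\<in>S. card (?E s)) = card (\<Union>s\<in>S. ?E s)"
  proof (rule card_UN_disjoint[symmetric, OF finite_rels])
    show "\<forall>s\<in>S. finite (?E s)" using fin by blast
    show "\<forall>r\<in>S. \<forall>s\<in>S. r \<noteq> s \<longrightarrow> ?E r \<inter> ?E s = {}" using rel_eqI by blast
  qed
  also have "(\<Union>s\<in>S. ?E s) = {z. \<exists>s\<in>S. (x, z) \<in> s \<and> (y, z) \<in> s}" by blast
  finally have "of_nat (card {z. \<exists>s\<in>S. (x, z) \<in> s \<and> (y, z) \<in> s}) / (?N * ?k) = c * (0 - 1 / ?N) + 1 / ?N"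
    using c xy by (simp add: mscale_def adj_def Jnorm_def Id_on_iff)
  then have "of_nat (card {z. \<exists>s\<in>S. (x, z) \<in> s \<and> (y, z) \<in> s}) / (?N * ?k) * (?N * ?k)
      = (c * (0 - 1 / ?N) + 1 / ?N) * (?N * ?k)" by (rule arg_cong)
  moreover have "q / (?N * ?k) * (?N * ?k) = q" for q using N k by simp
  ultimately have "of_nat (card {z. \<exists>s\<in>S. (x, z) \<in> s \<and> (y, z) \<in> s})
      = (c * (0 - 1 / ?N) + 1 / ?N) * (?N * ?k)" by (simp only:)
  also have "\<dots> = ?k - c * ?k" using N by (simp add: field_simps)
  also have "\<dots> = of_nat (k - 1)" using k ck by (simp add: of_nat_diff)
  finally show ?thesis by (simp only: of_nat_eq_iff)
qed

section \<open>Colours and algebraic isomorphisms\<close>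

definition colour :: "'a \<Rightarrow> 'a \<Rightarrow> ('a \<times> 'a) set" where
  "colour x y = (THE s. s \<in> S \<and> (x, y) \<in> s)"

lemma colour_eq:
  assumes "s \<in> S" "(x, y) \<in> s"
  shows "colour x y = s"
  unfolding colour_def
proof (rule the_equality)
  show "s \<in> S \<and> (x, y) \<in> s" using assms by blast
  show "r = s" if "r \<in> S \<and> (x, y) \<in> r" for r
    using that rel_eqI[of r s "(x, y)"] assms by blast
qed

lemma colour_in:
  assumes "x \<in> \<Omega>" "y \<in> \<Omega>"
  shows "colour x y \<in> S" "(x, y) \<in> colour x y"
proof -
  obtain s where "s \<in> S" "(x, y) \<in> s" using rel_cover assms by blast
  then show "colour x y \<in> S" "(x, y) \<in> colour x y" using colour_eq by auto
qed

lemma mem_colour: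
  assumes "s \<in> S"
  shows "(x, y) \<in> s \<longleftrightarrow> x \<in> \<Omega> \<and> y \<in> \<Omega> \<and> colour x y = s"
  using rel_subset[OF assms] colour_eq[OF assms] colour_in by blast

lemma colour_converse: "x \<in> \<Omega> \<Longrightarrow> y \<in> \<Omega> \<Longrightarrow> colour y x = (colour x y)\<inverse>"
  using colour_in[of x y] by (intro colour_eq converse_in) auto

lemma colour_swap:
  assumes "x \<in> \<Omega>" "y \<in> \<Omega>" "u \<in> \<Omega>" "v \<in> \<Omega>"
  shows "colour y x = colour v u \<longleftrightarrow> colour x y = colour u v"
  using assms by (simp add: colour_converse[of x y] colour_converse[of u v])

lemma colour_Id: "x \<in> \<Omega> \<Longrightarrow> y \<in> \<Omega> \<Longrightarrow> colour x y = Id_on \<Omega> \<longleftrightarrow> x = y"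
  using mem_colour[OF Id_in, of x y] by auto

lemma cnt_colour:
  assumes "r \<in> S" "s \<in> S"
  shows "cnt r s x y = card {z \<in> \<Omega>. x \<in> \<Omega> \<and> y \<in> \<Omega> \<and> colour x z = r \<and> colour z y = s}"
  unfolding cnt_def mem_colour[OF assms(1)] mem_colour[OF assms(2)]
  by (rule arg_cong[of _ _ card]) auto

lemma inum_cnt:
  assumes "r \<in> S" "s \<in> S" "t \<in> S" "(x, y) \<in> t"
  shows "inum r s t = cnt r s x y"
proof -
  have "(SOME p. p \<in> t) \<in> t" using assms(4) by (rule someI)
  then show ?thesis
    unfolding inum_def Let_def using cnt_eq[OF assms(1,2,3) _ assms(4)] by (metis prod.collapse)
qed

lemma cnt_pos_iff:
  assumes "r \<in> S" "s \<in> S" "x \<in> \<Omega>" "y \<in> \<Omega>"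
  shows "cnt r s x y > 0 \<longleftrightarrow> (\<exists>z\<in>\<Omega>. colour x z = r \<and> colour z y = s)"
  unfolding cnt_colour[OF assms(1,2)] using assms finite_points by (auto simp: card_gt_0_iff)

lemma valency_inum: "s \<in> S \<Longrightarrow> valency s = inum s (s\<inverse>) (Id_on \<Omega>)"
proof -
  assume s: "s \<in> S"
  obtain x where x: "x \<in> \<Omega>" using points_nonempty by blast
  have "inum s (s\<inverse>) (Id_on \<Omega>) = cnt s (s\<inverse>) x x"
    using x by (intro inum_cnt s converse_in Id_in) auto
  then show ?thesis using row_card[OF s x] by (simp add: cnt_def)
qed

end

section \<open>Algebraic isomorphisms and transfer of triangles\<close>

locale scheme_isomorphism = association_scheme \<Omega> S + B: association_scheme \<Omega>' S'
  for \<Omega> :: "'a set" and S and \<Omega>' :: "'b set" and S' +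
  fixes \<phi> :: "('a \<times> 'a) set \<Rightarrow> ('b \<times> 'b) set"
  assumes iso: "algebraic_isomorphism S S' \<phi>"
begin

lemma phi_bij: "bij_betw \<phi> S S'"
  using iso by (simp add: algebraic_isomorphism_def)

lemma phi_in: "s \<in> S \<Longrightarrow> \<phi> s \<in> S'"
  using phi_bij by (rule bij_betwE[rule_format])

lemma phi_inj: "r \<in> S \<Longrightarrow> s \<in> S \<Longrightarrow> \<phi> r = \<phi> s \<longleftrightarrow> r = s"
  using phi_bij by (metis bij_betw_inv_into_left)

lemma phi_surj: "s' \<in> S' \<Longrightarrow> \<exists>s\<in>S. \<phi> s = s'"
  using phi_bij by (metis bij_betw_imp_surj_on imageE)

lemma phi_inum: "\<lbrakk>r \<in> S; s \<in> S; t \<in> S\<rbrakk> \<Longrightarrow> inum (\<phi> r) (\<phi> s) (\<phi> t) = inum r s t"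
  using iso by (simp add: algebraic_isomorphism_def)

abbreviation compatible :: "'a \<Rightarrow> 'b \<Rightarrow> 'a \<Rightarrow> 'b \<Rightarrow> bool" where
  "compatible x x' y y' \<equiv> B.colour x' y' = \<phi> (colour x y)"

lemma phi_cnt:
  assumes "r \<in> S" "s \<in> S" "x \<in> \<Omega>" "y \<in> \<Omega>" "x' \<in> \<Omega>'" "y' \<in> \<Omega>'" "compatible x x' y y'"
  shows "cnt (\<phi> r) (\<phi> s) x' y' = cnt r s x y"
proof -
  note xy = colour_in[OF assms(3,4)] and xy' = B.colour_in[OF assms(5,6)]
  have "cnt (\<phi> r) (\<phi> s) x' y' = inum (\<phi> r) (\<phi> s) (\<phi> (colour x y))"
    using B.inum_cnt[OF phi_in[OF assms(1)] phi_in[OF assms(2)] xy'] assms(7) by simp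
  then show ?thesis using phi_inum[OF assms(1,2) xy(1)] inum_cnt[OF assms(1,2) xy] by simp
qed

text \<open>Only the intersection numbers are known to be preserved. Let \<open>e\<close> be the
  relation sent to the diagonal. As the diagonal is a left unit for
  \<open>\<phi> (Id_on \<Omega>)\<close>, pulling back yields a point \<open>z\<close> with
  \<open>colour x z = e\<close> and \<open>colour z x = Id_on \<Omega>\<close>, so
  \<open>z = x\<close> and \<open>e\<close> is the diagonal.\<close>

lemma phi_Id: "\<phi> (Id_on \<Omega>) = Id_on \<Omega>'"
proof -
  obtain e where e: "e \<in> S" "\<phi> e = Id_on \<Omega>'" using phi_surj[OF B.Id_in] by blast
  let ?u = "\<phi> (Id_on \<Omega>)"
  obtain x' y' where xy': "(x', y') \<in> ?u" using B.rel_nonempty[OF phi_in[OF Id_in]] by fastforce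
  have m: "x' \<in> \<Omega>'" "y' \<in> \<Omega>'" "B.colour x' y' = ?u"
    using xy' B.mem_colour[OF phi_in[OF Id_in]] by auto
  obtain x where x: "x \<in> \<Omega>" using points_nonempty by blast
  have xx: "colour x x = Id_on \<Omega>" using colour_Id x by blast
  have "cnt (Id_on \<Omega>') ?u x' y' > 0"
    using m B.colour_Id[of x' x'] by (subst B.cnt_pos_iff) (auto intro: phi_in Id_in B.Id_in)
  then have "cnt e (Id_on \<Omega>) x x > 0"
    using phi_cnt[OF e(1) Id_in x x m(1,2)] m(3) e(2) xx by simp
  then obtain z where z: "z \<in> \<Omega>" "colour x z = e" "colour z x = Id_on \<Omega>"
    using cnt_pos_iff[OF e(1) Id_in x x] by blast
  then have "e = Id_on \<Omega>" using colour_Id x xx by metis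
  then show ?thesis using e(2) by simp
qed

text \<open>The converse of \<open>s\<close> is the only relation whose product with
  \<open>s\<close> meets the diagonal, and intersection numbers detect this once the diagonal is
  preserved.\<close>

lemma phi_converse:
  assumes s: "s \<in> S"
  shows "\<phi> (s\<inverse>) = (\<phi> s)\<inverse>"
proof -
  note s' = converse_in[OF s]
  obtain x y where xy: "(x, y) \<in> s" using rel_nonempty[OF s] by fastforce
  then have m: "x \<in> \<Omega>" "y \<in> \<Omega>" "colour x y = s" using mem_colour[OF s] by auto
  obtain x' where x': "x' \<in> \<Omega>'" using B.points_nonempty by blast
  have "cnt s (s\<inverse>) x x > 0"
    using m colour_converse[of x y] by (subst cnt_pos_iff[OF s s']) auto
  moreover have "compatible x x' x x'" using colour_Id[of x x] B.colour_Id[of x' x'] m(1) x' phi_Id by simp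
  ultimately have "cnt (\<phi> s) (\<phi> (s\<inverse>)) x' x' > 0" using phi_cnt[OF s s' m(1) m(1) x' x'] by simp
  then obtain z' where "z' \<in> \<Omega>'" "B.colour x' z' = \<phi> s" "B.colour z' x' = \<phi> (s\<inverse>)"
    using B.cnt_pos_iff[OF phi_in[OF s] phi_in[OF s'] x' x'] by blast
  then show ?thesis using B.colour_converse[of x' z'] x' by simp
qed

lemma compatible_sym:
  assumes "x \<in> \<Omega>" "y \<in> \<Omega>" "x' \<in> \<Omega>'" "y' \<in> \<Omega>'" "compatible x x' y y'"
  shows "compatible y y' x x'"
  using assms colour_in[of x y]
  by (simp add: colour_converse[of x y] B.colour_converse[of x' y'] phi_converse)

text \<open>A triangle with given side colours exists exactly if an intersection number is positive.
  The transferred point need not be unique.\<close>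

lemma triangle_transfer:
  assumes "x \<in> \<Omega>" "y \<in> \<Omega>" "z \<in> \<Omega>" "x' \<in> \<Omega>'" "y' \<in> \<Omega>'" "compatible x x' y y'"
  shows "\<exists>z'\<in>\<Omega>'. compatible x x' z z' \<and> compatible z z' y y'"
proof -
  note r = colour_in(1)[OF assms(1,3)] and s = colour_in(1)[OF assms(3,2)]
  have "cnt (colour x z) (colour z y) x y > 0" using cnt_pos_iff[OF r s assms(1,2)] assms(3) by blast
  then show ?thesis
    using phi_cnt[OF r s assms(1,2,4,5,6)] B.cnt_pos_iff[OF phi_in[OF r] phi_in[OF s] assms(4,5)] by simp
qed

lemma triangle_transfer_back:
  assumes "x \<in> \<Omega>" "y \<in> \<Omega>" "z' \<in> \<Omega>'" "x' \<in> \<Omega>'" "y' \<in> \<Omega>'" "compatible x x' y y'"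
  shows "\<exists>z\<in>\<Omega>. compatible x x' z z' \<and> compatible z z' y y'"
proof -
  obtain r s where r: "r \<in> S" "\<phi> r = B.colour x' z'" and s: "s \<in> S" "\<phi> s = B.colour z' y'"
    using phi_surj B.colour_in(1) assms(3,4,5) by metis
  have "cnt (\<phi> r) (\<phi> s) x' y' > 0"
    using B.cnt_pos_iff[OF phi_in[OF r(1)] phi_in[OF s(1)] assms(4,5)] assms(3) r(2) s(2) by auto
  then have "cnt r s x y > 0" using phi_cnt[OF r(1) s(1) assms(1,2,4,5,6)] by simp
  then show ?thesis using cnt_pos_iff[OF r(1) s(1) assms(1,2)] r(2) s(2) by auto
qed

lemma valency_phi:
  assumes s: "s \<in> S" shows "valency (\<phi> s) = valency s"
  using valency_inum[OF s] B.valency_inum[OF phi_in[OF s]] phi_inum[OF s converse_in[OF s] Id_in]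
  by (simp add: phi_converse[OF s] phi_Id)

lemma card_points_phi: "card \<Omega>' = card \<Omega>"
  using B.sum_valency sum_valency sum.reindex_bij_betw[OF phi_bij, of valency]
  by (simp add: valency_phi)

end

section \<open>Points and colours pinned down by two base points\<close>

context association_scheme
begin

definition determined :: "'a \<Rightarrow> 'a \<Rightarrow> 'a \<Rightarrow> bool" where
  "determined d a b \<longleftrightarrow> (\<forall>x\<in>\<Omega>. colour x a = colour d a \<longrightarrow> colour x b = colour d b \<longrightarrow> x = d)"

text \<open>There are two witnesses \<open>x\<close> and \<open>y\<close> because a point of the
  other scheme is pulled back separately along its triangles over \<open>(g, a)\<close> and
  \<open>(g, b)\<close>, and the two results may differ.\<close>

definition forced :: "'a \<Rightarrow> 'a \<Rightarrow> 'a \<Rightarrow> 'a \<Rightarrow> bool" where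
  "forced d g a b \<longleftrightarrow> (\<forall>x\<in>\<Omega>. \<forall>y\<in>\<Omega>. colour x a = colour d a \<longrightarrow> colour y b = colour d b \<longrightarrow>
    colour x g = colour y g \<longrightarrow> colour x g = colour d g)"

end

text \<open>Pulling \<open>d'\<close> back, \<open>x\<close> reproduces its colours to
  \<open>g'\<close> and \<open>a'\<close>, and \<open>y\<close> those to \<open>g'\<close> and
  \<open>b'\<close>. Both have the same colour to \<open>g\<close>, coming from
  \<open>(d', g')\<close>, and \<open>forced\<close> says that it is the colour of
  \<open>d\<close>.\<close>

lemma (in scheme_isomorphism) forced_compatible:
  assumes pts: "a \<in> \<Omega>" "b \<in> \<Omega>" "d \<in> \<Omega>" "g \<in> \<Omega>" "a' \<in> \<Omega>'" "b' \<in> \<Omega>'" "d' \<in> \<Omega>'" "g' \<in> \<Omega>'"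
    and d: "compatible d d' a a'" "compatible d d' b b'"
    and g: "compatible a a' g g'" "compatible b b' g g'"
    and forced: "forced d g a b"
  shows "compatible d d' g g'"
proof -
  have ga: "compatible g g' a a'" by (rule compatible_sym[OF pts(1,4,5,8) g(1)])
  have gb: "compatible g g' b b'" by (rule compatible_sym[OF pts(2,4,6,8) g(2)])
  obtain x where x: "x \<in> \<Omega>" "compatible g g' x d'" "compatible x d' a a'"
    using triangle_transfer_back[OF pts(4,1,7,8,5) ga] by blast
  obtain y where y: "y \<in> \<Omega>" "compatible g g' y d'" "compatible y d' b b'"
    using triangle_transfer_back[OF pts(4,2,7,8,6) gb] by blast
  have xg: "compatible x d' g g'" by (rule compatible_sym[OF pts(4) x(1) pts(8,7) x(2)])
  have yg: "compatible y d' g g'" by (rule compatible_sym[OF pts(4) y(1) pts(8,7) y(2)])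
  have "colour x a = colour d a"
    using x(3) d(1) phi_inj[OF colour_in(1)[OF x(1) pts(1)] colour_in(1)[OF pts(3,1)]] by simp
  moreover have "colour y b = colour d b"
    using y(3) d(2) phi_inj[OF colour_in(1)[OF y(1) pts(2)] colour_in(1)[OF pts(3,2)]] by simp
  moreover have "colour x g = colour y g"
    using xg yg phi_inj[OF colour_in(1)[OF x(1) pts(4)] colour_in(1)[OF y(1) pts(4)]] by simp
  ultimately have "colour x g = colour d g" using forced x(1) y(1) unfolding forced_def by blast
  then show ?thesis using xg by simp
qed

section \<open>Extending partial isomorphisms\<close>

lemma card_UN_bound:
  assumes "finite I" "card I \<le> m" "\<And>i. i \<in> I \<Longrightarrow> card (A i) \<le> n"
  shows "card (\<Union>i\<in>I. A i) \<le> m * n"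
proof -
  have "card (\<Union>i\<in>I. A i) \<le> (\<Sum>i\<in>I. card (A i))" by (rule card_UN_le[OF assms(1)])
  also have "\<dots> \<le> card I * n" using sum_bounded_above[of I "\<lambda>i. card (A i)" n] assms(3) by simp
  also have "\<dots> \<le> m * n" using assms(2) by simp
  finally show ?thesis .
qed

text \<open>Collects the combinatorial consequences of pseudocyclicity on which the extension
  argument rests.\<close>

locale sparse_scheme = association_scheme +
  fixes k :: nat
  assumes valency_k: "\<And>s. s \<in> S \<Longrightarrow> s \<noteq> Id_on \<Omega> \<Longrightarrow> valency s = k"
    and k_gt_1: "k > 1"
    and indistinguishing: "\<And>x y. \<lbrakk>x \<in> \<Omega>; y \<in> \<Omega>; x \<noteq> y\<rbrakk> \<Longrightarrow> card {z \<in> \<Omega>. colour x z = colour y z} \<le> k - 1"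
    and many_points: "5 * (k * (k * (k - 1))) < card \<Omega>"
begin

section \<open>Bounds for the exceptional points\<close>

abbreviation eqs :: "'a \<Rightarrow> 'a \<Rightarrow> 'a set" where
  "eqs x y \<equiv> {z \<in> \<Omega>. colour x z = colour y z}"

lemma card_points_gt_1: "card \<Omega> > 1"
proof -
  have "k * (k * (k - 1)) > 0" using k_gt_1 by simp
  then show ?thesis using many_points by linarith
qed

lemma card_sphere:
  assumes "a \<in> \<Omega>" "d \<in> \<Omega>"
  shows "card {x \<in> \<Omega>. colour x a = colour d a} \<le> k"
proof -
  note ad = colour_in(1)[OF assms]
  have "{x \<in> \<Omega>. colour x a = colour d a} = {x. (a, x) \<in> colour a d}"
    using assms colour_swap[of a _ a d] by (auto simp: mem_colour[OF ad])
  then have "card {x \<in> \<Omega>. colour x a = colour d a} = valency (colour a d)"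
    using row_card[OF ad assms(1)] by simp
  also have "\<dots> \<le> k" using valency_k[OF ad] valency_Id k_gt_1 by (cases "colour a d = Id_on \<Omega>") auto
  finally show ?thesis .
qed

text \<open>A failing \<open>g\<close> does not separate some \<open>x\<close> on the sphere about
  \<open>a\<close> from some \<open>y\<close> on the sphere about \<open>b\<close>. These are
  distinct, because a common point would be \<open>d\<close> by \<open>determined\<close>; so each
  of the at most \<open>k * k\<close> pairs accounts for at most \<open>k - 1\<close> points
  \<open>g\<close>.\<close>

lemma card_not_forced:
  assumes pts: "a \<in> \<Omega>" "b \<in> \<Omega>" "d \<in> \<Omega>" and det: "determined d a b"
  shows "card {g \<in> \<Omega>. \<not> forced d g a b} \<le> k * (k * (k - 1))"
proof -
  let ?X = "{x \<in> \<Omega>. colour x a = colour d a}" and ?Y = "{y \<in> \<Omega>. colour y b = colour d b}"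
  let ?B = "\<Union>x\<in>?X. \<Union>y\<in>?Y - {x}. eqs x y"
  have "{g \<in> \<Omega>. \<not> forced d g a b} \<subseteq> ?B"
  proof
    fix g assume g: "g \<in> {g \<in> \<Omega>. \<not> forced d g a b}"
    then obtain x y where xy: "x \<in> ?X" "y \<in> ?Y" "colour x g = colour y g" "colour x g \<noteq> colour d g"
      by (auto simp: forced_def)
    then have "x \<noteq> y" using det by (auto simp: determined_def)
    then show "g \<in> ?B" using xy g by blast
  qed
  moreover have "finite ?B" using finite_points by auto
  ultimately have "card {g \<in> \<Omega>. \<not> forced d g a b} \<le> card ?B" by (rule card_mono[rotated])
  also have "\<dots> \<le> k * (k * (k - 1))"
  proof (intro card_UN_bound)
    fix x assume x: "x \<in> ?X"
    show "card (?Y - {x}) \<le> k"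
      using card_sphere[OF pts(2,3)] card_Diff1_le[of ?Y x] by linarith
    show "card (eqs x y) \<le> k - 1" if "y \<in> ?Y - {x}" for y
      using that x by (intro indistinguishing) auto
  qed (use card_sphere pts finite_points in auto)
  finally show ?thesis .
qed

text \<open>Here the base point \<open>b\<close> varies while \<open>g\<close> is fixed. The witness
  \<open>y\<close> lies on the sphere about \<open>g\<close> through \<open>x\<close> and differs
  from \<open>d\<close>, as their colours to \<open>g\<close> differ; \<open>b\<close> is one of the
  points that do not separate \<open>y\<close> from \<open>d\<close>.\<close>

lemma card_not_forced_base:
  assumes pts: "a \<in> \<Omega>" "d \<in> \<Omega>" "g \<in> \<Omega>"
  shows "card {b \<in> \<Omega>. \<not> forced d g a b} \<le> k * (k * (k - 1))"
proof -
  let ?X = "{x \<in> \<Omega>. colour x a = colour d a}" and ?Y = "\<lambda>x. {y \<in> \<Omega>. colour y g = colour x g}"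
  let ?B = "\<Union>x\<in>?X. \<Union>y\<in>?Y x - {d}. eqs y d"
  have "{b \<in> \<Omega>. \<not> forced d g a b} \<subseteq> ?B"
  proof
    fix b assume b: "b \<in> {b \<in> \<Omega>. \<not> forced d g a b}"
    then obtain x y where xy: "x \<in> ?X" "y \<in> \<Omega>" "colour y b = colour d b"
      "colour x g = colour y g" "colour x g \<noteq> colour d g"
      by (auto simp: forced_def)
    then have "y \<in> ?Y x - {d}" by auto
    then show "b \<in> ?B" using xy b by blast
  qed
  moreover have "finite ?B" using finite_points by auto
  ultimately have "card {b \<in> \<Omega>. \<not> forced d g a b} \<le> card ?B" by (rule card_mono[rotated])
  also have "\<dots> \<le> k * (k * (k - 1))"
  proof (intro card_UN_bound)
    fix x assume x: "x \<in> ?X"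
    then show "card (?Y x - {d}) \<le> k"
      using card_sphere[OF pts(3), of x] card_Diff1_le[of "?Y x" d] by auto
    show "card (eqs y d) \<le> k - 1" if "y \<in> ?Y x - {d}" for y
      using that pts by (intro indistinguishing) auto
  qed (use card_sphere pts finite_points in auto)
  finally show ?thesis .
qed

text \<open>A failing \<open>g\<close> does not separate \<open>d\<close> from another point of the
  sphere about \<open>a\<close> through \<open>d\<close>.\<close>

lemma card_not_determined:
  assumes pts: "a \<in> \<Omega>" "d \<in> \<Omega>"
  shows "card {g \<in> \<Omega>. \<not> determined d a g} \<le> k * (k - 1)"
proof -
  let ?X = "{x \<in> \<Omega>. colour x a = colour d a}"
  let ?B = "\<Union>x\<in>?X - {d}. eqs x d"
  have "{g \<in> \<Omega>. \<not> determined d a g} \<subseteq> ?B" by (auto simp: determined_def)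
  moreover have "finite ?B" using finite_points by auto
  ultimately have "card {g \<in> \<Omega>. \<not> determined d a g} \<le> card ?B" by (rule card_mono[rotated])
  also have "\<dots> \<le> k * (k - 1)"
  proof (intro card_UN_bound)
    show "card (?X - {d}) \<le> k" using card_sphere[OF pts] card_Diff1_le[of ?X d] by linarith
    show "card (eqs x d) \<le> k - 1" if "x \<in> ?X - {d}" for x
      using that pts by (intro indistinguishing) auto
  qed (use finite_points in auto)
  finally show ?thesis .
qed

text \<open>Both counts of the triangles at \<open>a\<close> with given side colours are \<open>k\<close> times an
  intersection number, as all nontrivial valencies agree.\<close>

lemma determined_flip:
  assumes pts: "a \<in> \<Omega>" "b \<in> \<Omega>" "g \<in> \<Omega>" "a \<noteq> b" and det: "determined b a g"
  shows "determined g a b"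
\<comment> \<open>For \<open>g = a\<close> the colour of \<open>(a, g)\<close> has valency 1 instead
  of \<open>k\<close>, so the double count does not apply; but only \<open>a\<close> has the
  diagonal colour to \<open>a\<close>.\<close>
proof (cases "g = a")
  case True
  then show ?thesis using colour_Id pts unfolding determined_def by metis
next
  case False
  define r u t where "r = colour a b" and "u = colour a g" and "t = colour b g"
  have in_S: "r \<in> S" "u \<in> S" "t \<in> S" "t\<inverse> \<in> S"
    unfolding r_def u_def t_def using pts by (auto intro: colour_in converse_in)
  have nId: "r \<noteq> Id_on \<Omega>" "u \<noteq> Id_on \<Omega>"
    unfolding r_def u_def using pts False colour_Id by auto
  let ?R = "{y. (a, y) \<in> r}" and ?U = "{z. (a, z) \<in> u}"
  have fin: "finite ?R" "finite ?U"
    by (rule finite_subset[OF _ finite_points]; use in_S rel_subset in blast)+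
  have cards: "card ?R = k" "card ?U = k"
    using row_card[OF in_S(1) pts(1)] row_card[OF in_S(2) pts(1)] valency_k in_S nId by auto
  have "(\<Sum>y\<in>?R. card {z \<in> ?U. (y, z) \<in> t}) = (\<Sum>z\<in>?U. card {y \<in> ?R. (y, z) \<in> t})"
    using sum.swap_restrict[OF fin, of "\<lambda>_ _. 1::nat" "\<lambda>y z. (y, z) \<in> t"] by simp
  moreover have "card {z \<in> ?U. (y, z) \<in> t} = cnt u (t\<inverse>) a b" if "y \<in> ?R" for y
    using that cnt_eq[OF in_S(2,4,1), of a y a b] colour_in(2)[OF pts(1,2)] by (simp add: cnt_def r_def)
  moreover have "card {y \<in> ?R. (y, z) \<in> t} = cnt r t a g" if "z \<in> ?U" for z
    using that cnt_eq[OF in_S(1,3,2), of a z a g] colour_in(2)[OF pts(1,3)] by (simp add: cnt_def u_def)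
  ultimately have "k * cnt u (t\<inverse>) a b = k * cnt r t a g" using cards by simp
  then have "cnt u (t\<inverse>) a b = cnt r t a g" using k_gt_1 by simp
  \<comment> \<open>By \<open>determined b a g\<close> one of the two intersection numbers is 1,
    hence so is the other.\<close>
  moreover have "{y. (a, y) \<in> r \<and> (y, g) \<in> t} = {b}"
  proof (intro equalityI subsetI)
    fix y assume "y \<in> {y. (a, y) \<in> r \<and> (y, g) \<in> t}"
    then have "y \<in> \<Omega>" "colour a y = colour a b" "colour y g = colour b g"
      using mem_colour in_S by (auto simp: r_def t_def)
    then show "y \<in> {b}" using det colour_swap[of a y a b] pts unfolding determined_def by blast
  qed (use pts colour_in in \<open>auto simp: r_def t_def\<close>)
  ultimately have "card {z. (a, z) \<in> u \<and> (z, b) \<in> t\<inverse>} = 1" by (simp add: cnt_def)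
  then obtain w where w: "{z. (a, z) \<in> u \<and> (z, b) \<in> t\<inverse>} = {w}" by (rule card_1_singletonE)
  have only: "z = w" if "z \<in> \<Omega>" "colour z a = colour g a" "colour z b = colour g b" for z
  proof -
    have "colour a z = u" "colour b z = t"
      using that pts colour_swap[of a z a g] colour_swap[of b z b g] by (auto simp: u_def t_def)
    then have "(a, z) \<in> u" "(b, z) \<in> t" using colour_in(2) pts that(1) by auto
    then show ?thesis using w by blast
  qed
  then show ?thesis using only[of g] pts unfolding determined_def by auto
qed

text \<open>Now the varying point is the one to be determined; \<open>determined_flip\<close>
  reduces this to the previous count, where it is a base point.\<close>

lemma card_not_determined':
  assumes "a \<in> \<Omega>" "b \<in> \<Omega>" "a \<noteq> b"
  shows "card {g \<in> \<Omega>. \<not> determined g a b} \<le> k * (k - 1)"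
proof -
  have "{g \<in> \<Omega>. \<not> determined g a b} \<subseteq> {g \<in> \<Omega>. \<not> determined b a g}"
    using determined_flip assms by blast
  then have "card {g \<in> \<Omega>. \<not> determined g a b} \<le> card {g \<in> \<Omega>. \<not> determined b a g}"
    using finite_points by (intro card_mono) auto
  then show ?thesis using card_not_determined[OF assms(1,2)] by linarith
qed

lemma point_outside: "A \<subseteq> \<Omega> \<Longrightarrow> card A < card \<Omega> \<Longrightarrow> \<exists>g\<in>\<Omega>. g \<notin> A"
  by (metis less_irrefl subsetI subset_antisym)

text \<open>\<open>d\<close> itself need not be determined by \<open>a\<close> and \<open>b\<close>.
  It is reached in two stages through \<open>g\<close>, which exists because the unsuitable points
  are fewer than \<open>card \<Omega>\<close>.\<close>

lemma determined_link:
  assumes "a \<in> \<Omega>" "b \<in> \<Omega>" "d \<in> \<Omega>" "a \<noteq> b"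
  shows "\<exists>g\<in>\<Omega>. determined g a b \<and> determined d a g"
proof -
  let ?A = "{g \<in> \<Omega>. \<not> determined g a b} \<union> {g \<in> \<Omega>. \<not> determined d a g}"
  have "card ?A \<le> k * (k - 1) + k * (k - 1)"
    using card_Un_le[of "{g \<in> \<Omega>. \<not> determined g a b}" "{g \<in> \<Omega>. \<not> determined d a g}"]
      card_not_determined'[OF assms(1,2,4)] card_not_determined[OF assms(1,3)] by linarith
  moreover have "k * (k - 1) \<le> k * (k * (k - 1))" using k_gt_1 by simp
  ultimately have "card ?A < card \<Omega>" using many_points by linarith
  then obtain g where "g \<in> \<Omega>" "g \<notin> ?A" using point_outside[of ?A] by blast
  then show ?thesis by blast
qed

lemma fixes_two_points_imp_id:
  assumes f: "\<And>x. x \<in> \<Omega> \<Longrightarrow> f x \<in> \<Omega>" "\<And>x y. x \<in> \<Omega> \<Longrightarrow> y \<in> \<Omega> \<Longrightarrow> colour (f x) (f y) = colour x y"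
    and ab: "a \<in> \<Omega>" "b \<in> \<Omega>" "a \<noteq> b" "f a = a" "f b = b" and d: "d \<in> \<Omega>"
  shows "f d = d"
proof -
  obtain g where g: "g \<in> \<Omega>" "determined g a b" "determined d a g"
    using determined_link[OF ab(1,2) d ab(3)] by blast
  have "colour (f g) a = colour g a" "colour (f g) b = colour g b" using f(2)[OF g(1)] ab by metis+
  then have fg: "f g = g" using g f(1) unfolding determined_def by blast
  have "colour (f d) a = colour d a" "colour (f d) g = colour d g" using f(2)[OF d] ab g(1) fg by metis+
  then show ?thesis using g(3) f(1) d unfolding determined_def by blast
qed

end

text \<open>The target scheme is controlled by pulling its triangles back to the source, where the
  counting bounds hold.\<close>

locale sparse_isomorphism = sparse_scheme \<Omega> S k + scheme_isomorphism \<Omega> S \<Omega>' S' \<phi>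
  for \<Omega> :: "'a set" and S k and \<Omega>' :: "'b set" and S' \<phi>
begin

lemma extension:
  assumes ab: "a \<in> \<Omega>" "b \<in> \<Omega>" "a \<noteq> b" and ab': "a' \<in> \<Omega>'" "b' \<in> \<Omega>'" "compatible a a' b b'"
  shows "\<exists>f. f a = a' \<and> f b = b' \<and> (\<forall>x\<in>\<Omega>. f x \<in> \<Omega>') \<and> (\<forall>x\<in>\<Omega>. \<forall>y\<in>\<Omega>. compatible x (f x) y (f y))"
proof -
  let ?m = "k * (k * (k - 1))"
  have "\<forall>g\<in>\<Omega>. \<exists>g'. g' \<in> \<Omega>' \<and> compatible a a' g g' \<and> compatible g g' b b'"
    using triangle_transfer[OF ab(1,2) _ ab'] by blast
  then obtain F where F: "\<And>g. g \<in> \<Omega> \<Longrightarrow> F g \<in> \<Omega>'" "\<And>g. g \<in> \<Omega> \<Longrightarrow> compatible a a' g (F g)"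
    "\<And>g. g \<in> \<Omega> \<Longrightarrow> compatible g (F g) b b'"
    by metis
  have Fb: "compatible b b' g (F g)" if "g \<in> \<Omega>" for g
    using compatible_sym[OF that ab(2) F(1)[OF that] ab'(2) F(3)[OF that]] .
  have Fa: "compatible g (F g) a a'" if "g \<in> \<Omega>" for g
    using compatible_sym[OF ab(1) that ab'(1) F(1)[OF that] F(2)[OF that]] .
  have F_forced: "compatible g (F g) h (F h)" if "g \<in> \<Omega>" "h \<in> \<Omega>" "forced g h a b" for g h
    by (rule forced_compatible[OF ab(1,2) that(1,2) ab'(1,2) F(1)[OF that(1)] F(1)[OF that(2)]
          Fa[OF that(1)] F(3)[OF that(1)] F(2)[OF that(2)] Fb[OF that(2)] that(3)])
  \<comment> \<open>\<open>F\<close> is chosen point by point from triangles over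
    \<open>(a, b)\<close>, and \<open>F_forced\<close> relates two of its values only for forced
    pairs. \<open>bad d d'\<close> measures how far a candidate image \<open>d'\<close> of
    \<open>d\<close> is from fitting \<open>F\<close>.\<close>
  define bad where "bad d d' = {g \<in> \<Omega>. \<not> compatible d d' g (F g)}" for d d'
  define good where "good d d' \<longleftrightarrow> d' \<in> \<Omega>' \<and> compatible a a' d d' \<and> card (bad d d') \<le> ?m + ?m" for d d'
  have good_exists: "\<exists>d'. good d d'" if d: "d \<in> \<Omega>" for d
  proof -
    obtain g where g: "g \<in> \<Omega>" "determined g a b" "determined d a g"
      using determined_link[OF ab(1,2) d ab(3)] by blast
    obtain d' where d': "d' \<in> \<Omega>'" "compatible a a' d d'" "compatible d d' g (F g)"
      using triangle_transfer[OF ab(1) g(1) d ab'(1) F(1,2)[OF g(1)]] by blast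
    have da: "compatible d d' a a'" by (rule compatible_sym[OF ab(1) d ab'(1) d'(1,2)])
    \<comment> \<open>Two sources of failure at \<open>h\<close>: \<open>F h\<close> may not fit
      \<open>F g\<close>, which \<open>forced g h a b\<close> excludes, and then \<open>d'\<close>
      may not fit \<open>F h\<close>, which \<open>forced d h a g\<close> excludes with
      \<open>a\<close> and \<open>g\<close> as base points.\<close>
    have "bad d d' \<subseteq> {h \<in> \<Omega>. \<not> forced g h a b} \<union> {h \<in> \<Omega>. \<not> forced d h a g}"
    proof
      fix h assume h: "h \<in> bad d d'"
      show "h \<in> {h \<in> \<Omega>. \<not> forced g h a b} \<union> {h \<in> \<Omega>. \<not> forced d h a g}"
      proof (rule ccontr)
        assume n: "\<not> ?thesis"
        have hO: "h \<in> \<Omega>" using h by (simp add: bad_def)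
        then have fo: "forced g h a b" "forced d h a g" using n by auto
        have gh: "compatible g (F g) h (F h)" by (rule F_forced[OF g(1) hO fo(1)])
        have "compatible d d' h (F h)"
          by (rule forced_compatible[OF ab(1) g(1) d hO ab'(1) F(1)[OF g(1)] d'(1) F(1)[OF hO] da d'(3)
                F(2)[OF hO] gh fo(2)])
        then show False using h by (simp add: bad_def)
      qed
    qed
    then have "card (bad d d') \<le> card ({h \<in> \<Omega>. \<not> forced g h a b} \<union> {h \<in> \<Omega>. \<not> forced d h a g})"
      using finite_points by (intro card_mono) auto
    also have "\<dots> \<le> card {h \<in> \<Omega>. \<not> forced g h a b} + card {h \<in> \<Omega>. \<not> forced d h a g}"
      by (rule card_Un_le)
    also have "\<dots> \<le> ?m + ?m"
      using card_not_forced[OF ab(1,2) g(1,2)] card_not_forced[OF ab(1) g(1) d g(3)] by linarith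
    finally show ?thesis using d' unfolding good_def by blast
  qed
  have "bad b b' = {}" using Fb by (auto simp: bad_def)
  then have "good b b'" using ab' by (simp add: good_def)
  \<comment> \<open>The value at \<open>b\<close> is prescribed, which is possible because
    \<open>b'\<close> fits \<open>F\<close> everywhere. The value at \<open>a\<close> comes out
    right by itself: \<open>\<phi>\<close> preserves the diagonal, so compatibility with
    \<open>a\<close> forces it to be \<open>a'\<close>.\<close>
  then have "\<forall>d\<in>\<Omega>. \<exists>d'. good d d' \<and> (d = b \<longrightarrow> d' = b')" using good_exists by metis
  then obtain f where f: "\<And>d. d \<in> \<Omega> \<Longrightarrow> good d (f d)" "f b = b'" using ab(2) by metis
  have f_in: "f d \<in> \<Omega>'" and f_a: "compatible a a' d (f d)" if "d \<in> \<Omega>" for d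
    using f(1)[OF that] by (simp_all add: good_def)
  have "compatible d (f d) e (f e)" if de: "d \<in> \<Omega>" "e \<in> \<Omega>" for d e
  proof -
    \<comment> \<open>A point \<open>g\<close> outside this set acts as a base point besides
      \<open>a\<close>: both \<open>f d\<close> and \<open>f e\<close> fit \<open>F g\<close>, so
      \<open>forced d e a g\<close> settles the pair. The last set is bounded by
      \<open>card_not_forced_base\<close> because \<open>d\<close> and \<open>e\<close> are given
      and the base point varies.\<close>
    let ?A = "bad d (f d) \<union> bad e (f e) \<union> {g \<in> \<Omega>. \<not> forced d e a g}"
    have "card ?A \<le> card (bad d (f d)) + card (bad e (f e)) + card {g \<in> \<Omega>. \<not> forced d e a g}"
      by (meson add_right_mono card_Un_le order_trans)
    also have "\<dots> \<le> (?m + ?m) + (?m + ?m) + ?m"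
      using f(1)[OF de(1)] f(1)[OF de(2)] card_not_forced_base[OF ab(1) de] unfolding good_def by linarith
    also have "\<dots> < card \<Omega>" using many_points by linarith
    finally obtain g where g: "g \<in> \<Omega>" "g \<notin> ?A"
      using point_outside[of ?A] by (auto simp: bad_def)
    have fo: "forced d e a g" and dg: "compatible d (f d) g (F g)" and eg: "compatible e (f e) g (F g)"
      using g by (auto simp: bad_def)
    have da: "compatible d (f d) a a'"
      by (rule compatible_sym[OF ab(1) de(1) ab'(1) f_in[OF de(1)] f_a[OF de(1)]])
    have ge: "compatible g (F g) e (f e)"
      by (rule compatible_sym[OF de(2) g(1) f_in[OF de(2)] F(1)[OF g(1)] eg])
    show ?thesis
      by (rule forced_compatible[OF ab(1) g(1) de ab'(1) F(1)[OF g(1)] f_in[OF de(1)] f_in[OF de(2)]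
            da dg f_a[OF de(2)] ge fo])
  qed
  moreover have "f a = a'"
    using f_a[OF ab(1)] f_in[OF ab(1)] colour_Id[OF ab(1,1)] phi_Id B.colour_Id[OF ab'(1) f_in[OF ab(1)]]
    by simp
  ultimately show ?thesis using f(2) f_in by blast
qed

text \<open>Injective because the diagonal colour is preserved and reflected; surjective because
  \<open>card_points_phi\<close> gives both point sets the same size.\<close>

lemma extension_bij:
  assumes f: "\<And>x. x \<in> \<Omega> \<Longrightarrow> f x \<in> \<Omega>'" "\<And>x y. x \<in> \<Omega> \<Longrightarrow> y \<in> \<Omega> \<Longrightarrow> compatible x (f x) y (f y)"
  shows "bij_betw f \<Omega> \<Omega>'"
proof -
  have inj: "inj_on f \<Omega>"
  proof (rule inj_onI)
    fix x y assume xy: "x \<in> \<Omega>" "y \<in> \<Omega>" "f x = f y"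
    then have "\<phi> (colour x y) = \<phi> (Id_on \<Omega>)"
      using f(2)[OF xy(1,2)] B.colour_Id[of "f x" "f y"] f(1) phi_Id by simp
    then show "x = y" using phi_inj colour_in(1) Id_in colour_Id xy by metis
  qed
  moreover have "f ` \<Omega> = \<Omega>'"
    using f(1) card_image[OF inj] card_points_phi B.finite_points by (intro card_subset_eq) auto
  ultimately show ?thesis by (simp add: bij_betw_def)
qed

lemma image_relation:
  assumes f: "bij_betw f \<Omega> \<Omega>'" "\<And>x y. x \<in> \<Omega> \<Longrightarrow> y \<in> \<Omega> \<Longrightarrow> compatible x (f x) y (f y)" and s: "s \<in> S"
  shows "(\<lambda>(x, y). (f x, f y)) ` s = \<phi> s"
proof (intro equalityI subsetI)
  fix p assume "p \<in> (\<lambda>(x, y). (f x, f y)) ` s"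
  then obtain x y where xy: "(x, y) \<in> s" "p = (f x, f y)" by auto
  then have "x \<in> \<Omega>" "y \<in> \<Omega>" "colour x y = s" using mem_colour[OF s] by auto
  then show "p \<in> \<phi> s"
    using f(2)[of x y] bij_betwE[OF f(1)] xy(2) B.mem_colour[OF phi_in[OF s]] by simp
next
  fix p assume p: "p \<in> \<phi> s"
  obtain x' y' where p': "p = (x', y')" by (cases p)
  then have xy': "x' \<in> \<Omega>'" "y' \<in> \<Omega>'" "B.colour x' y' = \<phi> s" using p B.mem_colour[OF phi_in[OF s]] by auto
  then obtain x y where xy: "x \<in> \<Omega>" "y \<in> \<Omega>" "x' = f x" "y' = f y"
    using f(1) by (metis bij_betw_imp_surj_on imageE)
  then have "colour x y = s" using f(2)[of x y] xy' phi_inj[OF colour_in(1) s] by simp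
  then have "(x, y) \<in> s" using colour_in(2)[OF xy(1,2)] by simp
  then show "p \<in> (\<lambda>(x, y). (f x, f y)) ` s" using p' xy by force
qed

text \<open>Any pair in the image of the colour of \<open>(a, b)\<close> can start the
  extension.\<close>

lemma isomorphism_exists:
  "\<exists>f. bij_betw f \<Omega> \<Omega>' \<and> (\<forall>s\<in>S. (\<lambda>(x, y). (f x, f y)) ` s = \<phi> s)"
proof -
  obtain a b where ab: "a \<in> \<Omega>" "b \<in> \<Omega>" "a \<noteq> b"
    using card_points_gt_1 finite_points by (metis card_le_Suc0_iff_eq leD One_nat_def)
  note r = colour_in(1)[OF ab(1,2)]
  obtain a' b' where "(a', b') \<in> \<phi> (colour a b)" using B.rel_nonempty[OF phi_in[OF r]] by fastforce
  then have "a' \<in> \<Omega>'" "b' \<in> \<Omega>'" "compatible a a' b b'" using B.mem_colour[OF phi_in[OF r]] by auto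
  then obtain f where f: "\<forall>x\<in>\<Omega>. f x \<in> \<Omega>'" "\<forall>x\<in>\<Omega>. \<forall>y\<in>\<Omega>. compatible x (f x) y (f y)"
    using extension[OF ab] by blast
  have bij: "bij_betw f \<Omega> \<Omega>'" by (rule extension_bij[OF f(1)[rule_format] f(2)[rule_format]])
  moreover have "(\<lambda>(x, y). (f x, f y)) ` s = \<phi> s" if "s \<in> S" for s
    by (rule image_relation[OF bij f(2)[rule_format] that])
  ultimately show ?thesis by blast
qed

end

section \<open>Separability and the Frobenius group\<close>

context sparse_scheme
begin

lemma separable: "separable TYPE('b) \<Omega> S"
  unfolding separable_def
proof (intro allI impI)
  fix \<Omega>' :: "'b set" and S' \<phi>
  assume "scheme \<Omega>' S' \<and> algebraic_isomorphism S S' \<phi>"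
  then interpret sparse_isomorphism \<Omega> S k \<Omega>' S' \<phi> by unfold_locales auto
  show "\<exists>f. bij_betw f \<Omega> \<Omega>' \<and> (\<forall>s\<in>S. (\<lambda>(x, y). (f x, f y)) ` s = \<phi> s)"
    by (rule isomorphism_exists)
qed

definition automorphisms :: "('a \<Rightarrow> 'a) set" where
  "automorphisms = {g. g permutes \<Omega> \<and> (\<forall>x\<in>\<Omega>. \<forall>y\<in>\<Omega>. colour (g x) (g y) = colour x y)}"

lemma automorphism_exists:
  assumes ab: "a \<in> \<Omega>" "b \<in> \<Omega>" "a \<noteq> b" and ab': "a' \<in> \<Omega>" "b' \<in> \<Omega>" "colour a' b' = colour a b"
  shows "\<exists>g\<in>automorphisms. g a = a' \<and> g b = b'"
proof -
  interpret I: sparse_isomorphism \<Omega> S k \<Omega> S "\<lambda>s. s"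
    by unfold_locales (simp add: algebraic_isomorphism_def bij_betw_def)
  obtain f where f: "f a = a'" "f b = b'" "\<forall>x\<in>\<Omega>. f x \<in> \<Omega>" "\<forall>x\<in>\<Omega>. \<forall>y\<in>\<Omega>. colour (f x) (f y) = colour x y"
    using I.extension[OF ab ab'] by blast
  \<comment> \<open>\<open>permutes\<close> demands fixed points outside \<open>\<Omega>\<close>,
    where \<open>f\<close> is arbitrary.\<close>
  define g where "g x = (if x \<in> \<Omega> then f x else x)" for x
  have "bij_betw f \<Omega> \<Omega>" using I.extension_bij f(3,4) by blast
  then have "bij_betw g \<Omega> \<Omega>" by (rule iffD1[OF bij_betw_cong, rotated]) (simp add: g_def)
  then have "g permutes \<Omega>" by (rule bij_imp_permutes) (simp add: g_def)
  then have "g \<in> automorphisms" using f(4) by (simp add: automorphisms_def g_def)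
  moreover have "g a = a'" "g b = b'" using f ab by (simp_all add: g_def)
  ultimately show ?thesis by blast
qed

lemma other_point:
  assumes "x \<in> \<Omega>" shows "\<exists>z\<in>\<Omega>. z \<noteq> x"
proof -
  have "card {x} < card \<Omega>" using card_points_gt_1 by simp
  then show ?thesis using point_outside[of "{x}"] assms by blast
qed

text \<open>\<open>automorphism_exists\<close> moves pairs of distinct points, so \<open>x\<close>
  and \<open>y\<close> are completed to pairs of one colour; the row of \<open>y\<close> is nonempty
  because all rows of a relation have the same size.\<close>

lemma automorphisms_transitive:
  assumes x: "x \<in> \<Omega>" and y: "y \<in> \<Omega>"
  shows "\<exists>g\<in>automorphisms. g x = y"
proof -
  obtain z where z: "z \<in> \<Omega>" "z \<noteq> x" using other_point[OF x] by blast
  note s = colour_in(1)[OF x z(1)]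
  have "{b. (y, b) \<in> colour x z} \<noteq> {}"
    using row_card[OF s y] valency_pos[OF s] by (metis card.empty less_irrefl)
  then obtain z' where "z' \<in> \<Omega>" "colour y z' = colour x z" using mem_colour[OF s] by blast
  then show ?thesis using automorphism_exists[OF x z(1) z(2)[symmetric] y] by blast
qed

lemma frobenius_group_automorphisms: "frobenius_group \<Omega> automorphisms"
  unfolding frobenius_group_def
proof (intro conjI ballI impI)
  show "g permutes \<Omega>" if "g \<in> automorphisms" for g using that by (simp add: automorphisms_def)
  show "id \<in> automorphisms" by (simp add: automorphisms_def permutes_id)
  show "g \<circ> h \<in> automorphisms" if "g \<in> automorphisms" "h \<in> automorphisms" for g h
    using that by (auto simp: automorphisms_def permutes_compose permutes_in_image)
  show "inv g \<in> automorphisms" if g: "g \<in> automorphisms" for g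
  proof -
    have p: "g permutes \<Omega>" using g by (simp add: automorphisms_def)
    have "colour (inv g x) (inv g y) = colour x y" if xy: "x \<in> \<Omega>" "y \<in> \<Omega>" for x y
    proof -
      have "inv g x \<in> \<Omega>" "inv g y \<in> \<Omega>" using xy permutes_in_image[OF permutes_inv[OF p]] by auto
      then have "colour (g (inv g x)) (g (inv g y)) = colour (inv g x) (inv g y)"
        using g by (simp add: automorphisms_def)
      then show ?thesis by (simp add: permutes_inverses(1)[OF p])
    qed
    then show ?thesis using permutes_inv[OF p] by (simp add: automorphisms_def)
  qed
  show "\<exists>g\<in>automorphisms. g x = y" if "x \<in> \<Omega>" "y \<in> \<Omega>" for x y
    by (rule automorphisms_transitive[OF that])
  show "\<exists>g\<in>automorphisms. g \<noteq> id \<and> (\<exists>x\<in>\<Omega>. g x = x)"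
  proof -
    obtain x where x: "x \<in> \<Omega>" using points_nonempty by blast
    obtain y where y: "y \<in> \<Omega>" "y \<noteq> x" using other_point[OF x] by blast
    note s = colour_in(1)[OF x y(1)]
    have "colour x y \<noteq> Id_on \<Omega>" using colour_Id x y by blast
    \<comment> \<open>Since the valency exceeds 1, some \<open>y' \<noteq> y\<close> has the same
      colour from \<open>x\<close>; an automorphism fixing \<open>x\<close> and moving
      \<open>y\<close> to \<open>y'\<close> shows that the group is not regular.\<close>
    then have "card {b. (x, b) \<in> colour x y} > 1"
      using row_card[OF s x] valency_k[OF s] k_gt_1 by simp
    then have "\<not> {b. (x, b) \<in> colour x y} \<subseteq> {y}"
      by (metis card.empty card.insert_remove card_mono finite.emptyI finite.insertI finite_insert
          insert_Diff_single leD One_nat_def card_1_singleton_iff)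
    then obtain y' where y': "y' \<noteq> y" "y' \<in> \<Omega>" "colour x y' = colour x y" using mem_colour[OF s] by auto
    obtain g where g: "g \<in> automorphisms" "g x = x" "g y = y'"
      using automorphism_exists[OF x y(1) y(2)[symmetric] x y'(2,3)] by blast
    then have "g \<noteq> id" using y'(1) by auto
    then show ?thesis using g x by blast
  qed
  show "g = id" if g: "g \<in> automorphisms" and xy: "x \<in> \<Omega>" "y \<in> \<Omega>" "x \<noteq> y \<and> g x = x \<and> g y = y" for g x y
  proof
    fix z
    have p: "g permutes \<Omega>" using g by (simp add: automorphisms_def)
    show "g z = id z"
    proof (cases "z \<in> \<Omega>")
      case True
      have "g z = z"
        by (rule fixes_two_points_imp_id[of g x y])
          (use g xy True permutes_in_image[OF p] in \<open>auto simp: automorphisms_def\<close>)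
      then show ?thesis by simp
    next
      case False
      then show ?thesis using permutes_not_in[OF p] by simp
    qed
  qed
qed

lemma orbit_eq_colour:
  assumes xy: "x \<in> \<Omega>" "y \<in> \<Omega>"
  shows "{(g x, g y) | g. g \<in> automorphisms} = colour x y"
proof (intro equalityI subsetI)
  note s = colour_in(1)[OF xy]
  fix p assume "p \<in> {(g x, g y) | g. g \<in> automorphisms}"
  then obtain g where g: "g \<in> automorphisms" "p = (g x, g y)" by blast
  have "g x \<in> \<Omega>" "g y \<in> \<Omega>" using g(1) xy permutes_in_image by (fastforce simp: automorphisms_def)+
  moreover have "colour (g x) (g y) = colour x y" using g(1) xy by (simp add: automorphisms_def)
  ultimately show "p \<in> colour x y" using g(2) mem_colour[OF s] by simp
next
  note s = colour_in(1)[OF xy]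
  fix p assume "p \<in> colour x y"
  then obtain x' y' where p: "p = (x', y')" "x' \<in> \<Omega>" "y' \<in> \<Omega>" "colour x' y' = colour x y"
    using mem_colour[OF s] by (cases p) auto
  show "p \<in> {(g x, g y) | g. g \<in> automorphisms}"
  \<comment> \<open>On the diagonal, transitivity takes the place of
    \<open>automorphism_exists\<close>, which concerns distinct points.\<close>
  proof (cases "x = y")
    case True
    then have "x' = y'" using p colour_Id xy by metis
    then show ?thesis using automorphisms_transitive[OF xy(1) p(2)] p(1) True by blast
  next
    case False
    then show ?thesis using automorphism_exists[OF xy False p(2,3,4)] p(1) by blast
  qed
qed

lemma frobenius_scheme: "frobenius_scheme \<Omega> S"
proof -
  have "S = orbitals \<Omega> automorphisms"
  proof (intro equalityI subsetI)
    fix s assume s: "s \<in> S"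
    obtain x y where "(x, y) \<in> s" using rel_nonempty[OF s] by fastforce
    then have "x \<in> \<Omega>" "y \<in> \<Omega>" "colour x y = s" using mem_colour[OF s] by auto
    then show "s \<in> orbitals \<Omega> automorphisms" using orbit_eq_colour[of x y] unfolding orbitals_def by blast
  next
    fix s assume "s \<in> orbitals \<Omega> automorphisms"
    then show "s \<in> S" using orbit_eq_colour colour_in(1) unfolding orbitals_def by auto
  qed
  then show ?thesis using frobenius_group_automorphisms unfolding frobenius_scheme_def by blast
qed

end

theorem theorem6p4:
  fixes \<Omega> :: "'a set" and S :: "('a \<times> 'a) set set" and k :: nat
  assumes "pseudocyclic \<Omega> S"
    and "\<forall>s\<in>S - {Id_on \<Omega>}. valency s = k"
    and "k > 1"
    and "rank S \<ge> 4 * (k - 1) * k ^ 3"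
  shows "frobenius_scheme \<Omega> S \<and> separable TYPE('b) \<Omega> S"
proof -
  interpret association_scheme \<Omega> S using assms(1) by unfold_locales (simp add: pseudocyclic_def)
  note N = card_points_eq[OF assms(2)]
  \<comment> \<open>The substitution removes the truncated subtraction, after which the inequality
    below holds coefficientwise in \<open>j\<close>. The summand 1 there pays for passing from
    \<open>card S\<close> to \<open>card S - 1\<close>.\<close>
  obtain j where j: "k = j + 2"
    using assms(3) by (metis add.commute less_imp_Suc_add Suc_1 add_Suc_right plus_1_eq_Suc)
  have "5 * (k * (k - 1)) + 1 \<le> 4 * (k - 1) * k ^ 3"
    unfolding j by (simp add: power3_eq_cube algebra_simps)
  then have "5 * (k * (k - 1)) \<le> card S - 1" using assms(4) unfolding rank_def by linarith
  then have "k * (5 * (k * (k - 1))) \<le> k * (card S - 1)" by (rule mult_le_mono2)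
  then have many: "5 * (k * (k * (k - 1))) < card \<Omega>" unfolding N by (simp add: algebra_simps)
  have indist: "card {z \<in> \<Omega>. colour x z = colour y z} \<le> k - 1" if xy: "x \<in> \<Omega>" "y \<in> \<Omega>" "x \<noteq> y" for x y
  proof -
    have "{z \<in> \<Omega>. colour x z = colour y z} = {z. \<exists>s\<in>S. (x, z) \<in> s \<and> (y, z) \<in> s}"
      using xy colour_in mem_colour by (auto; metis)
    then show ?thesis using pseudocyclic_indistinguishing[OF assms(1,2) xy] by simp
  qed
  interpret sparse_scheme \<Omega> S k
    by unfold_locales (use assms(2,3) many indist in auto)
  show ?thesis using frobenius_scheme separable by blast
qed

end
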